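(* Let $a<b$ be real numbers and let $W\in C^2(\mathbb{R})$ be a potential such that $W'(t)<0$ for every $t\in(a,b)$, $W'(a)=0$, and $W(t)\ge W(b)$ for every $t>b$. Suppose in addition that one of the following holds: (i) $n\ge 3$, and $W\in C^{6,\alpha}(b-\delta,b+\delta)$ for some $\delta>0$ and $\alpha\in(0,1)$; (ii) $n\ge 2$, and $W$ is convex in $(b-\delta,b)$ for some $\delta>0$. Let $u:\mathbb{R}^n\to\mathbb{R}$ be a $C^2$ solution to $\Delta u=W'(u)$ in $\mathbb{R}^n$ such that $u(\mathbb{R}^n\setminus B_R)\subset(a,b)$ for some $R>0$, and $\lim_{|x|\to\infty}u(x)=b$. Then $u<b$ in $\mathbb{R}^n$ and $u$ is radially symmetric.
   Context: $B_R\subset\mathbb{R}^n$ denotes the open ball of radius $R$ centred at the origin. "Radially symmetric" means radially symmetric about some point: there exist $x_0\in\mathbb{R}^n$ and a function $v:[0,\infty)\to\mathbb{R}$ such that $u(x)=v(|x-x_0|)$ for all $x\in\mathbb{R}^n$. *)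

theory Defs
  imports "HOL-Analysis.Analysis"
begin

definition partial_deriv ::
    "'a::euclidean_space \<Rightarrow> ('a \<Rightarrow> real) \<Rightarrow> 'a \<Rightarrow> real"
  where "partial_deriv e f x = deriv (\<lambda>t. f (x + t *\<^sub>R e)) 0"

definition laplacian :: "('a::euclidean_space \<Rightarrow> real) \<Rightarrow> 'a \<Rightarrow> real"
  where "laplacian f x = (\<Sum>e\<in>Basis. partial_deriv e (partial_deriv e f) x)"

text \<open>The class \<open>C\<^sup>k(S)\<close>, meaningful for open \<open>S\<close>. On the real line the only partial derivative
  is the ordinary one, since \<open>Basis = {1}\<close> there.\<close>

primrec Ck_on :: "nat \<Rightarrow> 'a::euclidean_space set \<Rightarrow> ('a \<Rightarrow> real) \<Rightarrow> bool" where
  "Ck_on 0 S f \<longleftrightarrow> continuous_on S f"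
| "Ck_on (Suc k) S f \<longleftrightarrow>
     (\<forall>x\<in>S. f differentiable (at x)) \<and> (\<forall>e\<in>Basis. Ck_on k S (partial_deriv e f))"

definition holder_on ::
    "real \<Rightarrow> 'a::metric_space set \<Rightarrow> ('a \<Rightarrow> 'b::metric_space) \<Rightarrow> bool"
  where "holder_on \<alpha> S f \<longleftrightarrow>
    (\<exists>C. \<forall>x\<in>S. \<forall>y\<in>S. dist (f x) (f y) \<le> C * dist x y powr \<alpha>)"

text \<open>The class \<open>C\<^sup>k\<^sup>,\<^sup>\<alpha>(S)\<close> for open \<open>S\<close>: the derivatives of order \<open>k\<close> are Hoelder continuous on
  compact subsets of \<open>S\<close>.\<close>

primrec Ck_alpha_on ::
    "nat \<Rightarrow> real \<Rightarrow> 'a::euclidean_space set \<Rightarrow> ('a \<Rightarrow> real) \<Rightarrow> bool" where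
  "Ck_alpha_on 0 \<alpha> S f \<longleftrightarrow> (\<forall>K\<subseteq>S. compact K \<longrightarrow> holder_on \<alpha> K f)"
| "Ck_alpha_on (Suc k) \<alpha> S f \<longleftrightarrow>
     (\<forall>x\<in>S. f differentiable (at x)) \<and> (\<forall>e\<in>Basis. Ck_alpha_on k \<alpha> S (partial_deriv e f))"

definition radially_symmetric :: "('a::euclidean_space \<Rightarrow> real) \<Rightarrow> bool"
  where "radially_symmetric u \<longleftrightarrow> (\<exists>x\<^sub>0. \<exists>v :: real \<Rightarrow> real. \<forall>x. u x = v (norm (x - x\<^sub>0)))"

text \<open>Agreement with the ordinary derivative in dimension one.\<close>

lemma partial_deriv_real: "partial_deriv (1::real) f = deriv f"
proof
  fix x :: real
  have "(f has_field_derivative D) (at x) \<longleftrightarrow>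
      ((\<lambda>t. f (x + t)) has_field_derivative D) (at 0)" for D
    using DERIV_at_within_shift[of f D x 0 UNIV] by simp
  then show "partial_deriv 1 f x = deriv f x"
    by (simp add: partial_deriv_def deriv_def)
qed

end

theory Submission
  imports Defs
begin

text \<open>The bound \<open>u \<le> b\<close> comes from comparing \<open>u\<close> with one-dimensional profiles: for
  \<open>Q' = (2 (W - W b) + \<eta>\<^sup>2)\<^sup>-\<^sup>1\<^sup>/\<^sup>2\<close> the function \<open>|x - p| + Q (u x)\<close> has no
  interior maximum on \<open>{u \<ge> b}\<close>, which bounds \<open>Q\<close> on the range of \<open>u\<close> uniformly in \<open>\<eta>\<close>,
  while \<open>Q\<close> diverges above \<open>b\<close> as \<open>\<eta> \<rightarrow> 0\<close>. The strong maximum principle then gives \<open>u < b\<close>.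

  Symmetry follows from the method of moving planes in every direction, by the Hopf lemma and a
  maximum principle near infinity. The latter needs a positive strict supersolution \<open>g\<close> of the
  linearised equation with \<open>b - u = o(g)\<close>. If \<open>W\<close> is convex to the left of \<open>b\<close>, then
  \<open>g = 2 - |x|\<^sup>-\<^sup>n\<close> works. If \<open>W\<close> is smooth near \<open>b\<close>, a Taylor expansion and \<open>W' < 0\<close> on
  \<open>(a, b)\<close> give \<open>W'' t \<ge> - K (b - t)\<^sup>3\<close>. For \<open>n \<ge> 3\<close> the subharmonic function \<open>b - u\<close> decays
  at least like \<open>|x|\<^sup>-\<^sup>1\<close>, so the potential in the linearised equation is at least
  \<open>- C |x|\<^sup>-\<^sup>3\<close>, and \<open>g = |x|\<^sup>-\<^sup>1\<^sup>/\<^sup>2\<close> works.\<close>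

section \<open>Gradients and Laplacians\<close>

text \<open>The gradient field \<open>G\<close> is carried along explicitly because chain rules and
  critical-point arguments need it together with the Laplacian. It is the gradient of
  \<open>f\<close> throughout a neighbourhood of \<open>x\<close>, while a derivative of
  \<open>G\<close>, with trace \<open>l\<close>, is asked for only at \<open>x\<close>.\<close>

definition has_lap :: "('a::euclidean_space \<Rightarrow> real) \<Rightarrow> ('a \<Rightarrow> 'a) \<Rightarrow> real \<Rightarrow> 'a \<Rightarrow> bool" where
  "has_lap f G l x \<longleftrightarrow> (\<forall>\<^sub>F y in nhds x. (f has_derivative (\<lambda>h. G y \<bullet> h)) (at y)) \<and>
     (\<exists>H. (G has_derivative H) (at x) \<and> l = (\<Sum>b\<in>Basis. H b \<bullet> b))"

lemma has_lapD:
  assumes "has_lap f G l x"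
  shows "(f has_derivative (\<lambda>h. G x \<bullet> h)) (at x)" "continuous (at x) f" "continuous (at x) G"
proof -
  show "(f has_derivative (\<lambda>h. G x \<bullet> h)) (at x)"
    using assms eventually_nhds_x_imp_x unfolding has_lap_def by fast
  then show "continuous (at x) f" by (rule has_derivative_continuous)
  show "continuous (at x) G"
    using assms has_derivative_continuous unfolding has_lap_def by blast
qed

text \<open>Bridge from iterated partial derivatives to \<open>has_lap\<close>: the partial
  derivatives are the components of the gradient, and differentiating these once more gives the
  Hessian, whose trace is the sum of the pure second partials.\<close>

lemma has_lap_Ck2:
  fixes u :: "'a::euclidean_space \<Rightarrow> real"
  assumes "Ck_on 2 UNIV u"
  shows "has_lap u (\<lambda>x. \<Sum>b\<in>Basis. partial_deriv b u x *\<^sub>R b) (laplacian u x) x"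
proof -
  let ?G = "\<lambda>x. \<Sum>b\<in>Basis. partial_deriv b u x *\<^sub>R b"
  have d: "u differentiable (at x)" for x
    using assms by (simp add: numeral_2_eq_2)
  have d2: "partial_deriv b u differentiable (at x)" if "b \<in> Basis" for x b
    using assms that by (simp add: numeral_2_eq_2)
  have line: "partial_deriv b f x = D b" if "(f has_derivative D) (at x)"
    for f :: "'a \<Rightarrow> real" and D x b
  proof -
    have "((\<lambda>t. f (x + t *\<^sub>R b)) has_derivative (\<lambda>t. D (t *\<^sub>R b))) (at 0)"
      by (rule has_derivative_compose[where f = "\<lambda>t. x + t *\<^sub>R b" and g = f])
         (auto intro!: derivative_eq_intros that)
    moreover have "D (t *\<^sub>R b) = D b * t" for t
      using linear_cmul[OF has_derivative_linear[OF that]] by simp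
    ultimately show ?thesis
      unfolding partial_deriv_def by (intro DERIV_imp_deriv, simp add: has_field_derivative_def)
  qed
  have "(u has_derivative (\<lambda>h. ?G y \<bullet> h)) (at y)" for y
  proof -
    obtain D where D: "(u has_derivative D) (at y)"
      using d unfolding differentiable_def by blast
    have "D h = ?G y \<bullet> h" for h
    proof -
      have "D h = D (\<Sum>b\<in>Basis. (h \<bullet> b) *\<^sub>R b)" by (simp add: euclidean_representation)
      also have "\<dots> = (\<Sum>b\<in>Basis. (h \<bullet> b) * D b)"
        using has_derivative_linear[OF D] by (simp add: linear_sum linear_cmul)
      also have "\<dots> = ?G y \<bullet> h"
        using line[OF D] by (simp add: inner_sum_left inner_sum_right inner_commute mult.commute)
      finally show ?thesis .
    qed
    then have "D = (\<lambda>h. ?G y \<bullet> h)" by blast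
    with D show ?thesis by simp
  qed
  moreover
  have "\<forall>b\<in>Basis. \<exists>D. (partial_deriv b u has_derivative D) (at x)"
    using d2 unfolding differentiable_def by blast
  then obtain D where D: "\<And>b. b \<in> Basis \<Longrightarrow> (partial_deriv b u has_derivative D b) (at x)"
    by metis
  have "(?G has_derivative (\<lambda>h. \<Sum>b\<in>Basis. D b h *\<^sub>R b)) (at x)"
    by (auto intro!: derivative_eq_intros D)
  moreover have "laplacian u x = (\<Sum>c\<in>Basis. (\<Sum>b\<in>Basis. D b c *\<^sub>R b) \<bullet> c)"
    unfolding laplacian_def using line[OF D]
    by (simp add: inner_sum_left inner_Basis if_distrib cong: if_cong)
  ultimately show ?thesis
    unfolding has_lap_def by (intro conjI always_eventually exI[of _ "\<lambda>h. \<Sum>b\<in>Basis. D b h *\<^sub>R b"]) auto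
qed

lemma has_lap_add:
  assumes "has_lap f G l x" "has_lap f' G' l' x"
  shows "has_lap (\<lambda>y. f y + f' y) (\<lambda>y. G y + G' y) (l + l') x"
proof -
  obtain H H' where H: "(G has_derivative H) (at x)" "l = (\<Sum>b\<in>Basis. H b \<bullet> b)"
    "(G' has_derivative H') (at x)" "l' = (\<Sum>b\<in>Basis. H' b \<bullet> b)"
    using assms unfolding has_lap_def by blast
  have "((\<lambda>y. G y + G' y) has_derivative (\<lambda>h. H h + H' h)) (at x)"
    using H by (auto intro!: derivative_eq_intros)
  moreover have "l + l' = (\<Sum>b\<in>Basis. (H b + H' b) \<bullet> b)"
    using H by (simp add: inner_add_left sum.distrib)
  moreover have "\<forall>\<^sub>F y in nhds x. ((\<lambda>y. f y + f' y) has_derivative (\<lambda>h. (G y + G' y) \<bullet> h)) (at y)"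
  proof -
    have "\<forall>\<^sub>F y in nhds x. (f has_derivative (\<lambda>h. G y \<bullet> h)) (at y)"
      "\<forall>\<^sub>F y in nhds x. (f' has_derivative (\<lambda>h. G' y \<bullet> h)) (at y)"
      using assms unfolding has_lap_def by blast+
    then show ?thesis
      by eventually_elim (simp add: inner_add_left has_derivative_add)
  qed
  ultimately show ?thesis unfolding has_lap_def by blast
qed

lemma has_lap_const: "has_lap (\<lambda>y. c) (\<lambda>y. 0) 0 x"
proof -
  have "(\<bullet>) (0::'a) = (\<lambda>_. 0)" by auto
  then show ?thesis
    unfolding has_lap_def by (intro conjI always_eventually exI[of _ "\<lambda>_. 0"]) auto
qed

text \<open>The Hessian of the composition is \<open>\<phi>'\<close> times that of \<open>f\<close>
  plus \<open>\<phi>2\<close> times the gradient tensored with itself; take traces. Derivatives of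
  \<open>\<phi>\<close> are demanded only near or at \<open>f x\<close>, which admits roots, powers
  and integrals that are singular elsewhere.\<close>

lemma has_lap_compose:
  assumes "has_lap f G l x"
    and "\<forall>\<^sub>F t in nhds (f x). (\<phi> has_real_derivative \<phi>' t) (at t)"
    and "(\<phi>' has_real_derivative \<phi>2) (at (f x))"
  shows "has_lap (\<lambda>y. \<phi> (f y)) (\<lambda>y. \<phi>' (f y) *\<^sub>R G y) (\<phi>2 * (norm (G x))\<^sup>2 + \<phi>' (f x) * l) x"
proof -
  obtain H where H: "(G has_derivative H) (at x)" "l = (\<Sum>b\<in>Basis. H b \<bullet> b)"
    using assms unfolding has_lap_def by blast
  have f: "(f has_derivative (\<lambda>h. G x \<bullet> h)) (at x)" using has_lapD[OF assms(1)] by simp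
  have 1: "((\<lambda>y. \<phi>' (f y)) has_derivative (\<lambda>h. \<phi>2 * (G x \<bullet> h))) (at x)"
    using has_derivative_compose[OF f, of \<phi>' "(*) \<phi>2"] assms(3)
    by (simp add: has_field_derivative_def)
  have "((\<lambda>y. \<phi>' (f y) *\<^sub>R G y) has_derivative (\<lambda>h. \<phi>' (f x) *\<^sub>R H h + (\<phi>2 * (G x \<bullet> h)) *\<^sub>R G x)) (at x)"
    using has_derivative_scaleR[OF 1 H(1)] .
  moreover have "\<phi>2 * (norm (G x))\<^sup>2 + \<phi>' (f x) * l
      = (\<Sum>b\<in>Basis. (\<phi>' (f x) *\<^sub>R H b + (\<phi>2 * (G x \<bullet> b)) *\<^sub>R G x) \<bullet> b)"
  proof -
    have "(norm (G x))\<^sup>2 = (\<Sum>b\<in>Basis. (G x \<bullet> b) * (G x \<bullet> b))"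
      by (simp add: power2_norm_eq_inner euclidean_inner[of "G x" "G x"])
    then show ?thesis using H(2)
      by (simp add: inner_add_left sum.distrib sum_distrib_left algebra_simps)
  qed
  moreover have "\<forall>\<^sub>F y in nhds x. ((\<lambda>y. \<phi> (f y)) has_derivative (\<lambda>h. (\<phi>' (f y) *\<^sub>R G y) \<bullet> h)) (at y)"
  proof -
    have "filterlim f (nhds (f x)) (nhds x)"
      using has_lapD(2)[OF assms(1)] by (simp add: isCont_def tendsto_at_iff_tendsto_nhds)
    then have "\<forall>\<^sub>F y in nhds x. (\<phi> has_real_derivative \<phi>' (f y)) (at (f y))"
      by (rule eventually_compose_filterlim[OF assms(2)])
    moreover have "\<forall>\<^sub>F y in nhds x. (f has_derivative (\<lambda>h. G y \<bullet> h)) (at y)"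
      using assms(1) unfolding has_lap_def by blast
    ultimately show ?thesis
    proof eventually_elim
      case (elim y)
      then show ?case
        using has_derivative_compose[of f "\<lambda>h. G y \<bullet> h" y UNIV \<phi> "(*) (\<phi>' (f y))"]
        by (simp add: has_field_derivative_def)
    qed
  qed
  ultimately show ?thesis unfolding has_lap_def by blast
qed

lemma has_lap_cmult:
  assumes "has_lap f G l x"
  shows "has_lap (\<lambda>y. c * f y) (\<lambda>y. c *\<^sub>R G y) (c * l) x"
proof -
  have "((\<lambda>t::real. c * t) has_real_derivative c) (at t)" for t
    by (auto intro!: derivative_eq_intros)
  then show ?thesis
    using has_lap_compose[OF assms, of "\<lambda>t. c * t" "\<lambda>_. c" 0] by simp
qed

lemma has_lap_diff:
  assumes "has_lap f G l x" "has_lap f' G' l' x"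
  shows "has_lap (\<lambda>y. f y - f' y) (\<lambda>y. G y - G' y) (l - l') x"
  using has_lap_add[OF assms(1) has_lap_cmult[OF assms(2), of "-1"]] by simp

lemma has_lap_sqdist:
  fixes p :: "'a::euclidean_space"
  shows "has_lap (\<lambda>y. (norm (y - p))\<^sup>2) (\<lambda>y. 2 *\<^sub>R (y - p)) (2 * real DIM('a)) x"
proof -
  have "((\<lambda>y. (norm (y - p))\<^sup>2) has_derivative (\<lambda>h. (2 *\<^sub>R (y - p)) \<bullet> h)) (at y)" for y
    unfolding power2_norm_eq_inner
    by (auto intro!: derivative_eq_intros simp: inner_commute algebra_simps)
  moreover have "((\<lambda>y. 2 *\<^sub>R (y - p)) has_derivative (\<lambda>h. 2 *\<^sub>R h)) (at x)"
    by (auto intro!: derivative_eq_intros)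
  moreover have "2 * real DIM('a) = (\<Sum>b::'a\<in>Basis. (2 *\<^sub>R b) \<bullet> b)"
    by (simp)
  ultimately show ?thesis unfolding has_lap_def by (intro conjI always_eventually exI[of _ "\<lambda>h. 2 *\<^sub>R h"]) blast+
qed

text \<open>For a unit vector \<open>e\<close> this is the reflection in the hyperplane
  \<open>x \<bullet> e = m\<close>; \<open>mirror e 0\<close> is its linear part, the map that acts
  on gradients.\<close>

definition mirror :: "'a::euclidean_space \<Rightarrow> real \<Rightarrow> 'a \<Rightarrow> 'a" where
  "mirror e m x = x - (2 * (x \<bullet> e - m)) *\<^sub>R e"

text \<open>The Hessian is conjugated by the linear part of the reflection, a symmetric involution,
  so its trace does not change.\<close>

lemma has_lap_mirror:
  assumes "norm e = 1" "has_lap f G l (mirror e m x)"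
  shows "has_lap (\<lambda>y. f (mirror e m y)) (\<lambda>y. mirror e 0 (G (mirror e m y))) l x"
proof -
  have ee: "e \<bullet> e = 1" using assms(1) by (simp add: norm_eq_1)
  have d: "(mirror e m has_derivative mirror e 0) (at y)" for y
    unfolding mirror_def by (auto intro!: derivative_eq_intros)
  have d0: "(mirror e 0 has_derivative mirror e 0) (at y)" for y
    unfolding mirror_def by (auto intro!: derivative_eq_intros)
  obtain H where H: "(G has_derivative H) (at (mirror e m x))" "l = (\<Sum>b\<in>Basis. H b \<bullet> b)"
    using assms unfolding has_lap_def by blast
  have lin: "linear H" using has_derivative_linear[OF H(1)] .
  have "((\<lambda>y. mirror e 0 (G (mirror e m y))) has_derivative (\<lambda>h. mirror e 0 (H (mirror e 0 h)))) (at x)"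
    by (rule has_derivative_compose[OF has_derivative_compose[OF d H(1)] d0])
  moreover have "l = (\<Sum>b\<in>Basis. mirror e 0 (H (mirror e 0 b)) \<bullet> b)"
  proof -
    have ie: "(\<Sum>b\<in>Basis. (b \<bullet> e) * (z \<bullet> b)) = z \<bullet> e" for z
      by (subst euclidean_inner[of z e]) (simp add: inner_commute mult.commute)
    have He: "(\<Sum>b\<in>Basis. (b \<bullet> e) * (H b \<bullet> e)) = H e \<bullet> e"
    proof -
      have "H e = H (\<Sum>b\<in>Basis. (e \<bullet> b) *\<^sub>R b)" by (simp add: euclidean_representation)
      also have "\<dots> = (\<Sum>b\<in>Basis. (e \<bullet> b) *\<^sub>R H b)" using lin by (simp add: linear_sum linear_cmul)
      finally show ?thesis by (simp add: inner_sum_left inner_sum_right inner_commute)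
    qed
    \<comment> \<open>Summed over the basis, the two mixed terms contribute
      \<open>- 2 * (H e \<bullet> e)\<close> each and the last one
      \<open>4 * (H e \<bullet> e)\<close>, so they cancel.\<close>
    have "mirror e 0 (H (mirror e 0 b)) \<bullet> b = H b \<bullet> b - 2 * ((b \<bullet> e) * (H e \<bullet> b))
        - 2 * ((b \<bullet> e) * (H b \<bullet> e)) + 4 * (H e \<bullet> e) * ((b \<bullet> e) * (e \<bullet> b))" for b
      using lin by (simp add: mirror_def linear_diff linear_cmul algebra_simps inner_commute)
    then have "(\<Sum>b\<in>Basis. mirror e 0 (H (mirror e 0 b)) \<bullet> b) = l - 2 * (H e \<bullet> e) - 2 * (H e \<bullet> e) + 4 * (H e \<bullet> e) * (e \<bullet> e)"
      by (simp only: sum.distrib sum_subtractf sum_distrib_left[symmetric] ie He H(2))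
    with ee show ?thesis by simp
  qed
  moreover have "\<forall>\<^sub>F y in nhds x. ((\<lambda>y. f (mirror e m y)) has_derivative (\<lambda>h. mirror e 0 (G (mirror e m y)) \<bullet> h)) (at y)"
  proof -
    have "filterlim (mirror e m) (nhds (mirror e m x)) (nhds x)"
      using has_derivative_continuous[OF d[of x]] by (simp add: isCont_def tendsto_at_iff_tendsto_nhds)
    then have "\<forall>\<^sub>F y in nhds x. (f has_derivative (\<lambda>h. G (mirror e m y) \<bullet> h)) (at (mirror e m y))"
      using assms(2) by (auto simp: filterlim_iff has_lap_def)
    then show ?thesis
    proof (eventually_elim, goal_cases)
      case (1 y)
      have "G (mirror e m y) \<bullet> mirror e 0 h = mirror e 0 (G (mirror e m y)) \<bullet> h" for h
        by (simp add: mirror_def algebra_simps inner_commute)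
      then show ?case using has_derivative_compose[OF d 1] by simp
    qed
  qed
  ultimately show ?thesis unfolding has_lap_def by blast
qed

text \<open>If a second directional derivative were negative, the slope in that direction, which is
  zero at \<open>x\<close>, would be negative just after \<open>x\<close>, and the mean value
  theorem would produce a smaller value. Only the derivative of \<open>G\<close> at \<open>x\<close>
  enters, not continuity of second derivatives.\<close>

lemma has_lap_local_min:
  assumes "has_lap f G l x" "\<forall>\<^sub>F y in nhds x. f x \<le> f y"
  shows "G x = 0" "l \<ge> 0"
proof -
  obtain r where r: "r > 0" and rm: "\<And>y. y \<in> ball x r \<Longrightarrow> f x \<le> f y"
    and rd: "\<And>y. y \<in> ball x r \<Longrightarrow> (f has_derivative (\<lambda>h. G y \<bullet> h)) (at y)"
  proof -
    have "\<forall>\<^sub>F y in nhds x. f x \<le> f y \<and> (f has_derivative (\<lambda>h. G y \<bullet> h)) (at y)"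
      using assms unfolding has_lap_def by (auto intro: eventually_conj)
    then show ?thesis using that unfolding eventually_nhds_metric by (metis dist_commute mem_ball)
  qed
  obtain H where H: "(G has_derivative H) (at x)" "l = (\<Sum>b\<in>Basis. H b \<bullet> b)"
    using assms unfolding has_lap_def by blast
  have "(\<lambda>h. G x \<bullet> h) = (\<lambda>h. 0)"
    by (rule has_derivative_local_min[OF rd]) (use r rm in \<open>auto simp: eventually_at dist_commute intro!: exI[of _ r]\<close>)
  then have "G x \<bullet> G x = 0" by metis
  then show G0: "G x = 0" by simp
  have "H d \<bullet> d \<ge> 0" if d: "norm d = 1" for d
  proof (rule ccontr)
    assume "\<not> H d \<bullet> d \<ge> 0"
    then have neg: "H d \<bullet> d < 0" by simp
    define \<phi> where "\<phi> t = G (x + t *\<^sub>R d) \<bullet> d" for t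
    have "((\<lambda>t. G (x + t *\<^sub>R d)) has_derivative (\<lambda>t. H (t *\<^sub>R d))) (at 0)"
      by (rule has_derivative_compose[where f = "\<lambda>t. x + t *\<^sub>R d" and g = G])
         (auto intro!: derivative_eq_intros H)
    then have "(\<phi> has_derivative (\<lambda>t. H (t *\<^sub>R d) \<bullet> d)) (at 0)"
      unfolding \<phi>_def by (auto intro!: derivative_eq_intros)
    then have "(\<phi> has_real_derivative (H d \<bullet> d)) (at 0)"
      using linear_cmul[OF has_derivative_linear[OF H(1)]]
      by (simp add: has_field_derivative_def mult_commute_abs)
    from DERIV_neg_dec_right[OF this neg] obtain s where s: "s > 0"
      and sneg: "\<And>h. 0 < h \<Longrightarrow> h < s \<Longrightarrow> \<phi> h < \<phi> 0" by auto
    define t where "t = min s r / 2"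
    have t: "0 < t" "t < s" "t < r" using s r by (auto simp: t_def)
    have der: "((\<lambda>t. f (x + t *\<^sub>R d)) has_real_derivative \<phi> h) (at h)" if "0 \<le> h" "h \<le> t" for h
    proof -
      have "x + h *\<^sub>R d \<in> ball x r" using that t d by (simp add: dist_norm)
      note D = rd[OF this]
      have "((\<lambda>t. f (x + t *\<^sub>R d)) has_derivative (\<lambda>s. G (x + h *\<^sub>R d) \<bullet> (s *\<^sub>R d))) (at h)"
        by (rule has_derivative_compose[where f = "\<lambda>t. x + t *\<^sub>R d" and g = f])
           (auto intro!: derivative_eq_intros D)
      then show ?thesis by (simp add: has_field_derivative_def \<phi>_def mult_commute_abs)
    qed
    obtain \<xi> where xi: "0 < \<xi>" "\<xi> < t" "f (x + t *\<^sub>R d) - f (x + 0 *\<^sub>R d) = (t - 0) * \<phi> \<xi>"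
      using MVT2[OF t(1), of "\<lambda>t. f (x + t *\<^sub>R d)" \<phi>] der by blast
    have "\<phi> \<xi> < 0" using sneg[of \<xi>] xi t G0 by (simp add: \<phi>_def)
    then have "f (x + t *\<^sub>R d) < f x" using xi(3) mult_pos_neg[OF t(1), of "\<phi> \<xi>"] by simp
    moreover have "x + t *\<^sub>R d \<in> ball x r" using t d by (simp add: dist_norm)
    ultimately show False using rm by fastforce
  qed
  then show "l \<ge> 0" unfolding H(2) by (intro sum_nonneg) auto
qed

section \<open>The Hopf lemma and the strong maximum principle\<close>

text \<open>On the annulus between radii \<open>r / 2\<close> and \<open>r\<close>, a small multiple
  of the barrier \<open>h\<close> lies below \<open>v\<close>, by a minimum argument. Both functions
  vanish at \<open>x0\<close>, so the inward slope of \<open>v\<close> there is at least that of the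
  multiple of \<open>h\<close>, which is positive.\<close>

lemma hopf_ball:
  fixes p x0 g :: "'a::euclidean_space"
  assumes r: "0 < r" and L: "0 \<le> L"
    and nonneg: "\<And>x. x \<in> cball p r \<Longrightarrow> 0 \<le> v x"
    and pos: "\<And>x. x \<in> ball p r \<Longrightarrow> 0 < v x"
    and lap: "\<And>x. x \<in> ball p r \<Longrightarrow> \<exists>l. has_lap v G l x \<and> l \<le> L * v x"
    and cont: "continuous_on (cball p r) v"
    and x0: "norm (x0 - p) = r" "v x0 = 0" "(v has_derivative (\<lambda>h. g \<bullet> h)) (at x0)"
  shows "g \<bullet> (p - x0) > 0"
proof -
  define n where "n = real DIM('a)"
  \<comment> \<open>Large enough that the factor \<open>4 * \<alpha>\<^sup>2 * (norm (x -
    p))\<^sup>2 - 2 * n * \<alpha>\<close> in the Laplacian of \<open>h\<close> exceeds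
    \<open>L\<close> already at radius \<open>r / 2\<close>.\<close>
  define \<alpha> where "\<alpha> = (2 * n + L + 1) / r\<^sup>2 + 1"
  have n: "n \<ge> 0" by (simp add: n_def)
  have \<alpha>1: "\<alpha> \<ge> 1" using r L n by (simp add: \<alpha>_def)
  have "\<alpha> * r\<^sup>2 \<ge> 2 * n + L + 1" using r by (simp add: \<alpha>_def field_simps)
  then have "\<alpha> * (\<alpha> * r\<^sup>2) \<ge> \<alpha> * (2 * n + L + 1)" using \<alpha>1 by (intro mult_left_mono) auto
  moreover have "\<alpha> * L \<ge> 1 * L" using \<alpha>1 L by (intro mult_right_mono) auto
  ultimately have \<alpha>: "\<alpha>\<^sup>2 * r\<^sup>2 - 2 * n * \<alpha> > L"
    using \<alpha>1 by (simp add: power2_eq_square algebra_simps)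
  define h where "h x = exp (- \<alpha> * (norm (x - p))\<^sup>2) - exp (- \<alpha> * r\<^sup>2)" for x
  define Gh where "Gh x = (- \<alpha> * exp (- \<alpha> * (norm (x - p))\<^sup>2)) *\<^sub>R (2 *\<^sub>R (x - p))" for x
  define lh where "lh x = exp (- \<alpha> * (norm (x - p))\<^sup>2) * (4 * \<alpha>\<^sup>2 * (norm (x - p))\<^sup>2 - 2 * n * \<alpha>)" for x
  have h: "has_lap h Gh (lh x) x" for x
  proof -
    have "has_lap h Gh (\<alpha>\<^sup>2 * exp (- \<alpha> * (norm (x - p))\<^sup>2) * (norm (2 *\<^sub>R (x - p)))\<^sup>2
        + - \<alpha> * exp (- \<alpha> * (norm (x - p))\<^sup>2) * (2 * real DIM('a))) x"
      unfolding h_def Gh_def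
      by (rule has_lap_compose[OF has_lap_sqdist, where \<phi> = "\<lambda>t. exp (- \<alpha> * t) - exp (- \<alpha> * r\<^sup>2)"
            and \<phi>' = "\<lambda>t. - \<alpha> * exp (- \<alpha> * t)"])
         (auto intro!: derivative_eq_intros always_eventually simp: power2_eq_square)
    moreover have "(norm (2 *\<^sub>R (x - p)))\<^sup>2 = 4 * (norm (x - p))\<^sup>2"
      unfolding norm_scaleR by (simp add: power_mult_distrib)
    ultimately show ?thesis unfolding lh_def n_def by (simp only:) (simp add: algebra_simps)
  qed
  have lh: "lh x > L * h x" if "norm (x - p) \<ge> r / 2" for x
  proof -
    have "(r/2)\<^sup>2 \<le> (norm (x - p))\<^sup>2" using that r by (intro power_mono) auto
    then have "4 * \<alpha>\<^sup>2 * (norm (x - p))\<^sup>2 \<ge> \<alpha>\<^sup>2 * r\<^sup>2"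
      using \<alpha>1 by (simp add: power_divide field_simps)
    then have "L < 4 * \<alpha>\<^sup>2 * (norm (x - p))\<^sup>2 - 2 * n * \<alpha>" using \<alpha> by simp
    then have "exp (- \<alpha> * (norm (x - p))\<^sup>2) * L < lh x" unfolding lh_def by simp
    moreover have "L * h x \<le> L * exp (- \<alpha> * (norm (x - p))\<^sup>2)"
      using L unfolding h_def by (intro mult_left_mono) auto
    ultimately show ?thesis by (simp add: mult.commute)
  qed
  have "\<exists>y\<in>cball p (r/2). \<forall>z\<in>cball p (r/2). v y \<le> v z"
    using r by (intro continuous_attains_inf continuous_on_subset[OF cont]) auto
  then obtain y where y: "y \<in> cball p (r/2)" "\<And>z. z \<in> cball p (r/2) \<Longrightarrow> v y \<le> v z" by blast
  \<comment> \<open>Since \<open>h\<close> is at most 1, the minimum of \<open>v\<close> over the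
    inner ball makes \<open>m * h\<close> at most \<open>v\<close> on the inner sphere.\<close>
  define m where "m = v y"
  have m: "m > 0" unfolding m_def using y r by (intro pos) auto
  define F where "F x = v x - m * h x" for x
  have h1: "h x \<le> 1" for x
  proof -
    have "exp (- \<alpha> * (norm (x - p))\<^sup>2) \<le> 1" using \<alpha>1 by simp
    then show ?thesis unfolding h_def using exp_gt_zero[of "- \<alpha> * r\<^sup>2"] by linarith
  qed
  have "continuous_on UNIV h" unfolding h_def by (intro continuous_intros)
  then have Fc: "continuous_on (cball p r) F"
    unfolding F_def by (intro continuous_intros cont) (auto intro: continuous_on_subset)
  have F0: "F x \<ge> 0" if x: "x \<in> cball p r - ball p (r/2)" for x
  proof (rule ccontr)
    assume neg: "\<not> F x \<ge> 0"
    have "\<exists>z\<in>cball p r - ball p (r/2). \<forall>y\<in>cball p r - ball p (r/2). F z \<le> F y"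
      using x by (intro continuous_attains_inf continuous_on_subset[OF Fc] compact_diff) auto
    then obtain z where z: "z \<in> cball p r - ball p (r/2)"
      "\<And>y. y \<in> cball p r - ball p (r/2) \<Longrightarrow> F z \<le> F y" by blast
    have Fz: "F z < 0" using z(2)[OF x] neg by simp
    have "norm (z - p) \<noteq> r"
    proof
      assume "norm (z - p) = r"
      then have "F z = v z" by (simp add: F_def h_def)
      then show False using Fz nonneg[of z] z by auto
    qed
    moreover have "norm (z - p) \<noteq> r / 2"
    proof
      assume "norm (z - p) = r / 2"
      then have "v z \<ge> m" unfolding m_def by (intro y) (simp add: dist_norm norm_minus_commute)
      moreover have "m * h z \<le> m" using h1[of z] m by simp
      ultimately show False using Fz by (simp add: F_def)
    qed
    ultimately have zi: "z \<in> ball p r - cball p (r/2)"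
      using z(1) by (auto simp: dist_norm norm_minus_commute)
    obtain l where l: "has_lap v G l z" "l \<le> L * v z" using lap zi by blast
    have "has_lap F (\<lambda>y. G y - m *\<^sub>R Gh y) (l - m * lh z) z"
      unfolding F_def by (intro has_lap_diff has_lap_cmult h l)
    moreover have "\<forall>\<^sub>F y in nhds z. F z \<le> F y"
    proof (rule eventually_mono[OF eventually_nhds_in_open[of "ball p r - cball p (r/2)"]])
      show "open (ball p r - cball p (r/2))" by (intro open_Diff) auto
      show "F z \<le> F y" if "y \<in> ball p r - cball p (r/2)" for y using that by (intro z(2)) auto
    qed (fact zi)
    \<comment> \<open>At a negative interior minimum of \<open>F\<close> its Laplacian is
      nonnegative, yet it is below \<open>L * F z\<close>, which is not positive.\<close>
    ultimately have "l - m * lh z \<ge> 0" by (rule has_lap_local_min)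
    moreover have "m * lh z > m * (L * h z)"
      using zi m by (intro mult_strict_left_mono lh) (auto simp: dist_norm norm_minus_commute)
    ultimately have "L * F z > 0" using l(2) by (simp add: F_def algebra_simps)
    then show False using Fz L by (simp add: zero_less_mult_iff)
  qed
  have Fd: "(F has_derivative (\<lambda>h. (g - m *\<^sub>R Gh x0) \<bullet> h)) (at x0)"
    unfolding F_def using x0(3) has_lapD(1)[OF h[of x0]]
    by (auto intro!: derivative_eq_intros simp: inner_diff_left)
  define D where "D = (g - m *\<^sub>R Gh x0) \<bullet> (p - x0)"
  have "((\<lambda>t. F (x0 + t *\<^sub>R (p - x0))) has_derivative (\<lambda>t. (g - m *\<^sub>R Gh x0) \<bullet> (t *\<^sub>R (p - x0)))) (at 0)"
    by (rule has_derivative_compose[where f = "\<lambda>t. x0 + t *\<^sub>R (p - x0)" and g = F])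
       (auto intro!: derivative_eq_intros Fd)
  then have Ft: "((\<lambda>t. F (x0 + t *\<^sub>R (p - x0))) has_real_derivative D) (at 0)"
    by (simp add: has_field_derivative_def D_def mult_commute_abs)
  have "D \<ge> 0"
  proof (rule ccontr)
    assume "\<not> D \<ge> 0"
    then have "D < 0" by simp
    from DERIV_neg_dec_right[OF Ft this] obtain s where s: "s > 0"
      "\<And>t. 0 < t \<Longrightarrow> t < s \<Longrightarrow> F (x0 + t *\<^sub>R (p - x0)) < F x0" by auto
    \<comment> \<open>A step of at most 1/2 towards the centre stays in the annulus on which
      \<open>F\<close> is known to be nonnegative.\<close>
    define t where "t = min s 1 / 2"
    have t: "0 < t" "t < s" "t \<le> 1/2" using s by (auto simp: t_def)
    have "p - (x0 + t *\<^sub>R (p - x0)) = (1 - t) *\<^sub>R (p - x0)" by (simp add: algebra_simps)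
    then have "dist p (x0 + t *\<^sub>R (p - x0)) = (1 - t) * r"
      using t x0(1) by (simp add: dist_norm norm_minus_commute)
    moreover have "(1 - t) * r \<le> r" "(1 - t) * r \<ge> (1/2) * r"
      using t r by (intro mult_left_le_one_le mult_right_mono; simp)+
    ultimately have "F (x0 + t *\<^sub>R (p - x0)) \<ge> 0" by (intro F0) auto
    moreover have "F x0 = 0" by (simp add: F_def h_def x0)
    ultimately show False using s(2)[OF t(1,2)] by simp
  qed
  moreover have "(m *\<^sub>R Gh x0) \<bullet> (p - x0) > 0"
  proof -
    have "(x0 - p) \<bullet> (p - x0) = - (r * r)"
      using x0(1) by (metis inner_minus_right minus_diff_eq power2_eq_square power2_norm_eq_inner)
    then have "(m *\<^sub>R Gh x0) \<bullet> (p - x0) = 2 * (m * (\<alpha> * (exp (- \<alpha> * r\<^sup>2) * (r * r))))"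
      by (simp add: Gh_def x0)
    then show ?thesis using m \<alpha>1 r by simp
  qed
  ultimately show ?thesis by (simp add: D_def inner_diff_left)
qed

text \<open>The zero set of \<open>v\<close> is relatively closed by continuity and open by the Hopf
  lemma, so connectedness of \<open>S\<close> makes it everything.\<close>

lemma strong_maximum_principle:
  fixes S :: "'a::euclidean_space set"
  assumes S: "open S" "connected S" and L: "0 \<le> L"
    and nonneg: "\<And>x. x \<in> S \<Longrightarrow> 0 \<le> v x"
    and lap: "\<And>x. x \<in> S \<Longrightarrow> \<exists>l. has_lap v G l x \<and> l \<le> L * v x"
    and z: "z \<in> S" "v z = 0" and x: "x \<in> S"
  shows "v x = 0"
proof -
  have cont: "continuous_on S v"
    using lap has_lapD(2) by (intro continuous_at_imp_continuous_on) blast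
  have loc: "\<exists>\<rho>>0. ball z \<rho> \<subseteq> {x \<in> S. v x = 0}" if z: "z \<in> S" "v z = 0" for z
  proof -
    obtain \<epsilon> where \<epsilon>: "\<epsilon> > 0" "ball z \<epsilon> \<subseteq> S" using S z openE by blast
    \<comment> \<open>Otherwise the largest zero-free ball about \<open>p\<close> touches the zero
      set at some \<open>x0\<close>. The Hopf lemma gives a nonzero gradient there, but
      \<open>x0\<close> is an interior minimum of \<open>v\<close>. The radius
      \<open>\<epsilon> / 2\<close> keeps this ball inside \<open>S\<close>.\<close>
    have "v p = 0" if p: "p \<in> ball z (\<epsilon>/2)" for p
    proof (rule ccontr)
      assume vp: "v p \<noteq> 0"
      have sub: "cball p (dist p z) \<subseteq> S"
      proof
        fix y assume "y \<in> cball p (dist p z)"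
        then have "dist z y < \<epsilon>" using p dist_triangle[of z y p] by (simp add: dist_commute)
        then show "y \<in> S" using \<epsilon> by auto
      qed
      let ?K = "cball p (dist p z) \<inter> v -` {0}"
      have "compact ?K"
        using continuous_closed_preimage[OF continuous_on_subset[OF cont sub] closed_cball, of "{0}"]
        by (auto simp: compact_eq_bounded_closed intro: bounded_subset[OF bounded_cball])
      moreover have "z \<in> ?K" using z by auto
      ultimately obtain x0 where x0: "x0 \<in> ?K" "\<And>y. y \<in> ?K \<Longrightarrow> dist p x0 \<le> dist p y"
        using distance_attains_inf[of ?K p] compact_imp_closed by blast
      define r where "r = dist p x0"
      have r: "r > 0" using x0 vp by (auto simp: r_def)
      have rz: "cball p r \<subseteq> cball p (dist p z)" using x0 by (auto simp: r_def)
      have pos: "v y > 0" if "y \<in> ball p r" for y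
      proof -
        have "y \<in> cball p r" using that by simp
        with rz have "y \<in> cball p (dist p z)" by blast
        moreover have "y \<notin> ?K" using x0(2)[of y] that by (auto simp: r_def)
        ultimately show ?thesis using nonneg[of y] sub by fastforce
      qed
      have x0S: "x0 \<in> S" using x0 sub by auto
      obtain l where l: "has_lap v G l x0" using lap[OF x0S] by blast
      have rS: "y \<in> S" if "y \<in> cball p r" for y using that rz sub by blast
      have "G x0 \<bullet> (p - x0) > 0"
      proof (rule hopf_ball[OF r L])
        show "0 \<le> v y" if "y \<in> cball p r" for y using nonneg rS that by blast
        show "0 < v y" if "y \<in> ball p r" for y using pos that .
        show "\<exists>l. has_lap v G l y \<and> l \<le> L * v y" if "y \<in> ball p r" for y
          using rS[of y] that by (intro lap) auto
        show "continuous_on (cball p r) v" using rS by (intro continuous_on_subset[OF cont]) auto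
        show "norm (x0 - p) = r" by (simp add: r_def dist_norm norm_minus_commute)
        show "v x0 = 0" using x0 by auto
        show "(v has_derivative (\<lambda>h. G x0 \<bullet> h)) (at x0)" using has_lapD(1)[OF l] .
      qed
      moreover have "G x0 = 0"
        using l
      proof (rule has_lap_local_min)
        show "\<forall>\<^sub>F y in nhds x0. v x0 \<le> v y"
          using eventually_nhds_in_open[OF S(1) x0S] x0(1) by (auto elim!: eventually_mono intro: nonneg)
      qed
      ultimately show False by simp
    qed
    then show ?thesis using \<epsilon> by (intro exI[of _ "\<epsilon>/2"]) (auto dest!: subsetD[OF \<epsilon>(2)])
  qed
  have "open {x \<in> S. v x = 0}" unfolding open_contains_ball using loc by blast
  moreover have "open {x \<in> S. v x \<noteq> 0}"
  proof -
    have "open (S \<inter> v -` (-{0}))" by (intro continuous_open_preimage cont S) auto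
    moreover have "S \<inter> v -` (-{0}) = {x \<in> S. v x \<noteq> 0}" by auto
    ultimately show ?thesis by simp
  qed
  ultimately show ?thesis using S(2) z x unfolding connected_def by blast
qed

section \<open>Moving planes\<close>

lemma mirror_on_plane: "x \<bullet> e = m \<Longrightarrow> mirror e m x = x"
  by (simp add: mirror_def)

lemma mirror_mirror: "norm e = 1 \<Longrightarrow> mirror e m (mirror e m x) = x"
  by (simp add: mirror_def inner_diff_left norm_eq_1 algebra_simps)

text \<open>The symmetry hyperplanes of the coordinate directions meet in a point \<open>p\<close>,
  and their reflections compose to the point reflection in \<open>p\<close>. A symmetry hyperplane
  missing \<open>p\<close> would then make \<open>u\<close> periodic, contrary to its limit being a
  value it never takes. So all of them pass through \<open>p\<close>, and points equidistant from
  \<open>p\<close> are exchanged by one of the reflections.\<close>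

lemma radially_symmetric_if_mirror_symmetric:
  fixes u :: "'a::euclidean_space \<Rightarrow> real"
  assumes sym: "\<And>e. norm e = 1 \<Longrightarrow> \<exists>m. \<forall>x. u (mirror e m x) = u x"
    and lim: "(u \<longlongrightarrow> b) at_infinity" and ne: "\<And>x. u x \<noteq> b"
  shows "radially_symmetric u"
proof -
  obtain m where m: "\<And>e x. norm e = 1 \<Longrightarrow> u (mirror e (m e) x) = u x"
    using sym by metis
  define p where "p = (\<Sum>c\<in>Basis. m c *\<^sub>R c)"
  have "u (x - (\<Sum>c\<in>B. (2 * (x \<bullet> c - m c)) *\<^sub>R c)) = u x" if "finite B" "B \<subseteq> Basis" for B x
    using that
  proof (induction B)
    case (insert c B)
    let ?x' = "x - (\<Sum>c\<in>B. (2 * (x \<bullet> c - m c)) *\<^sub>R c)"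
    \<comment> \<open>Reflections in other coordinate directions leave the coordinate along
      \<open>c\<close> untouched, so the displacements simply add up.\<close>
    have "(\<Sum>d\<in>B. (2 * (x \<bullet> d - m d)) *\<^sub>R d) \<bullet> c = 0"
      unfolding inner_sum_left using insert by (intro sum.neutral) (auto simp: inner_Basis subset_iff)
    then have "?x' \<bullet> c = x \<bullet> c" by (simp add: inner_diff_left)
    then have "mirror c (m c) ?x' = x - (\<Sum>c\<in>insert c B. (2 * (x \<bullet> c - m c)) *\<^sub>R c)"
      using insert by (simp add: mirror_def algebra_simps)
    moreover have "u (mirror c (m c) ?x') = u ?x'" using insert by (intro m) auto
    ultimately show ?case using insert by simp
  qed simp
  from this[OF finite_Basis order_refl]
  have central: "u (2 *\<^sub>R p - x) = u x" for x
  proof -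
    have "x - (\<Sum>c\<in>Basis. (2 * (x \<bullet> c - m c)) *\<^sub>R c)
        = x - (2 *\<^sub>R (\<Sum>c\<in>Basis. (x \<bullet> c) *\<^sub>R c) - 2 *\<^sub>R p)"
      by (simp add: p_def scaleR_sum_right sum_subtractf scaleR_diff_left right_diff_distrib)
    also have "\<dots> = 2 *\<^sub>R p - x" by (simp add: euclidean_representation algebra_simps scaleR_2)
    finally show ?thesis
      using \<open>\<And>x. u (x - (\<Sum>c\<in>Basis. (2 * (x \<bullet> c - m c)) *\<^sub>R c)) = u x\<close>[of x] by simp
  qed
  have center: "m e = p \<bullet> e" if e: "norm e = 1" for e
  proof (rule ccontr)
    assume "m e \<noteq> p \<bullet> e"
    \<comment> \<open>The symmetry \<open>s\<close> is the point reflection followed by the mirror;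
      its square is the translation by \<open>d *\<^sub>R e\<close>.\<close>
    define d where "d = 4 * (m e - p \<bullet> e)"
    have d: "d \<noteq> 0" using \<open>m e \<noteq> p \<bullet> e\<close> by (simp add: d_def)
    define s where "s x = mirror e (m e) (2 *\<^sub>R p - x)" for x
    have us: "u (s x) = u x" for x using m[OF e] central by (simp add: s_def)
    have ee: "e \<bullet> e = 1" using e by (simp add: norm_eq_1)
    have se: "s x \<bullet> e = x \<bullet> e + 2 * (m e - p \<bullet> e)" for x
      by (simp add: s_def mirror_def inner_diff_left ee)
    have s: "s x = 2 *\<^sub>R p - x + (2 * (x \<bullet> e) - 4 * (p \<bullet> e) + 2 * m e) *\<^sub>R e" for x
      by (simp add: s_def mirror_def inner_diff_left algebra_simps)
    have ss: "s (s x) = x + d *\<^sub>R e" for x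
    proof -
      have "s (s x) = 2 *\<^sub>R p - s x + (2 * (x \<bullet> e) - 8 * (p \<bullet> e) + 6 * m e) *\<^sub>R e"
        by (subst s) (simp add: se algebra_simps)
      also have "\<dots> = x + d *\<^sub>R e"
        by (simp add: s d_def algebra_simps) (simp flip: scaleR_add_left)
      finally show ?thesis .
    qed
    have per: "u (real k *\<^sub>R (d *\<^sub>R e)) = u 0" for k
    proof (induction k)
      case (Suc k)
      have "u (real (Suc k) *\<^sub>R (d *\<^sub>R e)) = u (s (s (real k *\<^sub>R (d *\<^sub>R e))))"
        unfolding ss by (simp add: algebra_simps)
      then show ?case using us Suc by simp
    qed simp
    have "filterlim (\<lambda>k. real k *\<^sub>R (d *\<^sub>R e)) at_infinity sequentially"
    proof -
      have "filterlim (\<lambda>k. real k * \<bar>d\<bar>) at_top sequentially"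
        using d by (intro filterlim_at_top_mult_tendsto_pos[OF tendsto_const] filterlim_real_sequentially) auto
      then show ?thesis
        using e by (simp add: filterlim_at_infinity_conv_norm_at_top abs_mult)
    qed
    from filterlim_compose[OF lim this] have "(\<lambda>k::nat. u 0) \<longlonglongrightarrow> b"
      by (simp only: per)
    then show False using ne[of 0] by (simp add: LIMSEQ_const_iff)
  qed
  have rad: "u x = u y" if "norm (x - p) = norm (y - p)" for x y
  proof (cases "x = y")
    case False
    \<comment> \<open>The perpendicular bisector of \<open>x\<close> and \<open>y\<close> passes
      through \<open>p\<close>, because both points have the same distance to
      \<open>p\<close>.\<close>
    define e where "e = (x - y) /\<^sub>R norm (x - y)"
    have e: "norm e = 1" using False by (simp add: e_def)
    have "(x - p) \<bullet> (x - p) = (y - p) \<bullet> (y - p)" using that by (simp add: norm_eq)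
    then have "2 * ((x - p) \<bullet> (x - y)) = (x - y) \<bullet> (x - y)"
      by (simp add: algebra_simps inner_commute)
    then have "2 * ((x - p) \<bullet> (x - y)) = norm (x - y) * norm (x - y)"
      by (simp add: power2_norm_eq_inner[symmetric] power2_eq_square)
    then have "2 * ((x - p) \<bullet> e) = norm (x - y)" using False unfolding e_def inner_scaleR_right
      by (simp add: divide_simps)
    then have "2 * (x \<bullet> e - p \<bullet> e) = norm (x - y)" by (simp add: inner_diff_left)
    then have "mirror e (p \<bullet> e) x = x - norm (x - y) *\<^sub>R e" by (simp add: mirror_def)
    also have "\<dots> = y" using False by (simp add: e_def)
    finally show ?thesis using m[OF e, of x] center[OF e] by simp
  qed simp
  obtain e0 :: 'a where e0: "e0 \<in> Basis" using nonempty_Basis by blast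
  have "u x = u (p + norm (x - p) *\<^sub>R e0)" for x
    using e0 by (intro rad) simp
  then show ?thesis
    unfolding radially_symmetric_def by (intro exI[of _ p] exI[of _ "\<lambda>r. u (p + r *\<^sub>R e0)"]) simp
qed

text \<open>The function \<open>g\<close> is a strict supersolution near infinity of the equation satisfied by the
  differences of \<open>u\<close> and its mirror images. Since \<open>b - u = o(g)\<close>, it serves as a weight
  for the maximum principle there.\<close>

locale moving_planes =
  fixes u :: "'a::euclidean_space \<Rightarrow> real" and G :: "'a \<Rightarrow> 'a" and f :: "real \<Rightarrow> real" and b L R0 :: real
    and g lg c0 :: "'a \<Rightarrow> real" and Gg :: "'a \<Rightarrow> 'a"
  assumes lapu: "\<And>x. has_lap u G (f (u x)) x"
    and ub: "\<And>x. u x < b"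
    and lim: "(u \<longlongrightarrow> b) at_infinity"
    and L: "L \<ge> 0" and Lip: "\<And>x y. \<bar>f (u x) - f (u y)\<bar> \<le> L * \<bar>u x - u y\<bar>"
    and lapg: "\<And>x. norm x \<ge> R0 \<Longrightarrow> has_lap g Gg (lg x) x"
    and gpos: "\<And>x. norm x \<ge> R0 \<Longrightarrow> g x > 0"
    and super: "\<And>x. norm x \<ge> R0 \<Longrightarrow> lg x < - (c0 x * g x)"
    and slope: "\<And>x t. norm x \<ge> R0 \<Longrightarrow> u x < t \<Longrightarrow> t < b \<Longrightarrow> f (u x) - f t \<le> c0 x * (t - u x)"
    and decay: "\<And>\<epsilon>. \<epsilon> > 0 \<Longrightarrow> \<exists>r. \<forall>x. norm x \<ge> r \<longrightarrow> b - u x \<le> \<epsilon> * g x"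
begin

text \<open>The sign suits a function that approaches its limit \<open>b\<close> from below: for a
  plane far out, points beyond it should carry larger values of \<open>u\<close> than their mirror
  images.\<close>

definition v :: "'a \<Rightarrow> real \<Rightarrow> 'a \<Rightarrow> real" where
  "v e m = (\<lambda>x. u x - u (mirror e m x))"

lemma has_lap_v:
  assumes "norm e = 1"
  shows "has_lap (v e m) (\<lambda>x. G x - mirror e 0 (G (mirror e m x))) (f (u x) - f (u (mirror e m x))) x"
  unfolding v_def by (intro has_lap_diff lapu has_lap_mirror assms)

lemma v_on_plane: "x \<bullet> e = m \<Longrightarrow> v e m x = 0"
  by (simp add: v_def mirror_on_plane)

lemma continuous_u: "continuous_on S u"
  using has_lapD(2)[OF lapu] by (simp add: continuous_at_imp_continuous_on)

lemma continuous_v: "norm e = 1 \<Longrightarrow> continuous_on S (v e m)"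
  using has_lapD(2)[OF has_lap_v] by (simp add: continuous_at_imp_continuous_on)

text \<open>The quotient \<open>v/g\<close> has nonnegative lower limit at infinity, so a negative value of it forces a
  negative minimum, which the strict supersolution \<open>g\<close> excludes outside the ball of radius \<open>R0\<close>.\<close>

lemma v_nonneg_from_ball:
  assumes e: "norm e = 1"
    and ball: "\<And>x. x \<bullet> e \<ge> m \<Longrightarrow> norm x \<le> R0 \<Longrightarrow> v e m x \<ge> 0"
    and x: "x \<bullet> e \<ge> m"
  shows "v e m x \<ge> 0"
proof (rule ccontr)
  assume "\<not> v e m x \<ge> 0"
  then have neg: "v e m x < 0" by simp
  then have xR: "norm x > R0" using ball x by force
  define q where "q y = v e m y / g y" for y
  have qx: "q x < 0" using neg gpos[of x] xR by (simp add: q_def field_simps)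
  obtain r where r: "\<And>y. norm y \<ge> r \<Longrightarrow> b - u y \<le> (- q x / 2) * g y"
    using decay[of "- q x / 2"] qx by auto
  \<comment> \<open>The reflected value of \<open>u\<close> is below \<open>b\<close>, so
    \<open>v\<close> exceeds \<open>u - b\<close>, which by \<open>decay\<close> is at least
    \<open>(q x / 2) * g y\<close>.\<close>
  have far: "q y > q x" if "norm y \<ge> r" "norm y \<ge> R0" for y
  proof -
    have "v e m y > - (- q x / 2 * g y)"
      using r[OF that(1)] ub[of "mirror e m y"] by (simp add: v_def)
    then have "q y > q x / 2" using gpos[OF that(2)] by (simp add: q_def field_simps)
    then show ?thesis using qx by simp
  qed
  let ?K = "{y. y \<bullet> e \<ge> m} \<inter> {y. norm y \<ge> R0} \<inter> cball 0 (max r (norm x))"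
  have "closed ({y. y \<bullet> e \<ge> m} \<inter> {y. norm y \<ge> R0})"
    by (intro closed_Int closed_Collect_le continuous_intros)
  then have "compact ?K" by (intro closed_Int_compact) auto
  moreover have "continuous_on ?K q"
  proof -
    have "continuous_on ?K g" using lapg has_lapD(2) by (intro continuous_at_imp_continuous_on) blast
    then show ?thesis unfolding q_def using gpos
      by (intro continuous_intros continuous_v e) force+
  qed
  moreover have xK: "x \<in> ?K" using x xR by auto
  ultimately obtain z where z: "z \<in> ?K" "\<And>y. y \<in> ?K \<Longrightarrow> q z \<le> q y"
    using continuous_attains_inf[of ?K q] by blast
  have zmin: "q z \<le> q y" if "y \<bullet> e \<ge> m" "norm y \<ge> R0" for y
  proof (cases "y \<in> ?K")
    case False
    then have "norm y \<ge> r" using that by auto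
    then show ?thesis using far[OF _ that(2)] z(2)[OF xK] by force
  qed (use z in blast)
  have qz: "q z < 0" using z(2)[OF xK] qx by simp
  have zR: "norm z \<ge> R0" and ze: "z \<bullet> e \<ge> m" using z(1) by auto
  note gz = gpos[OF zR]
  have vz: "v e m z = q z * g z" using gz by (simp add: q_def)
  then have vneg: "v e m z < 0" using qz gz by (simp add: mult_neg_pos)
  have "norm z > R0" using vneg ball[OF ze] by (cases "norm z \<le> R0") auto
  moreover have "z \<bullet> e > m" using vneg v_on_plane[of z e m] ze by (cases "z \<bullet> e = m") auto
  ultimately have zi: "z \<in> {y. y \<bullet> e > m} \<inter> {y. norm y > R0}" by simp
  have "open ({y. y \<bullet> e > m} \<inter> {y. norm y > R0})"
    by (intro open_Int open_Collect_less continuous_intros)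
  from eventually_nhds_in_open[OF this zi]
  \<comment> \<open>A minimum of the quotient at \<open>z\<close> is a local minimum of
    \<open>v - q z * g\<close>, which spares differentiating the quotient.\<close>
  have "\<forall>\<^sub>F y in nhds z. v e m z - q z * g z \<le> v e m y - q z * g y"
  proof eventually_elim
    case (elim y)
    then have gy: "g y > 0" and qy: "q z \<le> q y" using gpos[of y] zmin[of y] by simp_all
    then have "q z * g y \<le> q y * g y" by (simp add: mult_right_mono)
    then show ?case using vz gy by (simp add: q_def[of y])
  qed
  then have ge: "f (u z) - f (u (mirror e m z)) - q z * lg z \<ge> 0"
    by (rule has_lap_local_min(2)[OF has_lap_diff[OF has_lap_v[OF e] has_lap_cmult[OF lapg[OF zR]]]])
  have "f (u z) - f (u (mirror e m z)) \<le> c0 z * (u (mirror e m z) - u z)"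
    using vneg by (intro slope zR ub) (simp add: v_def)
  also have "\<dots> = - (q z * (c0 z * g z))" using vz by (simp add: v_def algebra_simps)
  also have "\<dots> < q z * lg z" using mult_strict_left_mono_neg[OF super[OF zR] qz] by simp
  finally show False using ge by simp
qed

text \<open>Planes are moved in from infinity to the last position \<open>\<mu>\<close> for which
  \<open>v\<close> is nonnegative there and for every larger \<open>m\<close>. If \<open>v\<close>
  vanishes somewhere beyond that plane, the strong maximum principle makes it vanish throughout.
  Otherwise violations for planes slightly further on accumulate at a point of the plane, where they
  contradict the Hopf lemma.\<close>

lemma moving_plane_stops:
  assumes e: "norm e = 1"
  shows "\<exists>m. (\<forall>x. x \<bullet> e \<ge> m \<longrightarrow> v e m x = 0)"
proof -
  have ee: "e \<bullet> e = 1" using e by (simp add: norm_eq_1)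
  define P where "P m \<longleftrightarrow> (\<forall>x. x \<bullet> e \<ge> m \<longrightarrow> v e m x \<ge> 0)" for m
  have xe: "x \<bullet> e \<le> norm x" for x using norm_cauchy_schwarz[of x e] e by simp
  \<comment> \<open>For such \<open>m\<close> the half-space misses the ball of radius
    \<open>R0\<close>, so the condition on the ball is vacuous.\<close>
  have start: "P m" if "m > R0" for m
    unfolding P_def
  proof (intro allI impI, rule v_nonneg_from_ball[OF e])
    show "v e m x \<ge> 0" if "x \<bullet> e \<ge> m" "norm x \<le> R0" for x using that \<open>m > R0\<close> xe[of x] by simp
  qed
  have "\<forall>\<^sub>F x in at_infinity. u x > u 0" using order_tendstoD(1)[OF lim ub] .
  then obtain r where r: "\<And>x. norm x \<ge> r \<Longrightarrow> u x > u 0" unfolding eventually_at_infinity by blast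
  \<comment> \<open>The origin then lies in the half-space, and its mirror image is so far out that
    \<open>u\<close> exceeds \<open>u 0\<close> there.\<close>
  have stop: "\<not> P m" if "m \<le> - \<bar>r\<bar>" for m
  proof -
    have "mirror e m 0 = (2 * m) *\<^sub>R e" by (simp add: mirror_def)
    moreover have "norm ((2 * m) *\<^sub>R e) \<ge> r" using that e by simp
    ultimately have "v e m 0 < 0" using r by (simp add: v_def)
    then show ?thesis unfolding P_def using that by (intro notI) (auto dest!: spec[of _ 0])
  qed
  define A where "A = {m. \<forall>m'\<ge>m. P m'}"
  have A1: "R0 + 1 \<in> A" unfolding A_def using start by auto
  have Ab: "- \<bar>r\<bar> \<le> m" if "m \<in> A" for m
  proof (rule ccontr)
    assume "\<not> - \<bar>r\<bar> \<le> m"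
    then have "P (- \<bar>r\<bar>)" using that by (simp add: A_def)
    then show False using stop by blast
  qed
  define \<mu> where "\<mu> = Inf A"
  have bdd: "bdd_below A" using Ab by (rule bdd_belowI)
  have above: "P m" if m: "m > \<mu>" for m
  proof -
    obtain a where "a \<in> A" "a < m" using cInf_lessD[of A m] m A1 by (auto simp: \<mu>_def)
    then show ?thesis by (simp add: A_def)
  qed
  have mirror_cont: "continuous_on UNIV (\<lambda>m. mirror e m x)" for x
    unfolding mirror_def by (intro continuous_intros)
  have P\<mu>: "P \<mu>"
    unfolding P_def
  proof (intro allI impI)
    fix x assume "x \<bullet> e \<ge> \<mu>"
    then consider "x \<bullet> e = \<mu>" | "x \<bullet> e > \<mu>" by linarith
    then show "v e \<mu> x \<ge> 0"
    proof cases
      case 2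
      have "isCont (\<lambda>m. v e m x) \<mu>"
        unfolding v_def
        using continuous_on_compose2[OF continuous_u[of UNIV] mirror_cont[of x]]
        by (auto intro!: continuous_intros simp: continuous_on_eq_continuous_at)
      \<comment> \<open>For \<open>m\<close> slightly above \<open>\<mu>\<close> the point
        \<open>x\<close> is still beyond the plane, so nonnegativity passes to the limit.\<close>
      then have "((\<lambda>m. v e m x) \<longlongrightarrow> v e \<mu> x) (at_right \<mu>)"
        unfolding isCont_def by (rule filterlim_mono) (auto simp: at_within_le_at)
      moreover have "\<forall>\<^sub>F m in at_right \<mu>. v e m x \<ge> 0"
        using eventually_at_right_real[OF 2] above by (auto elim!: eventually_mono simp: P_def)
      ultimately show ?thesis by (rule tendsto_lowerbound) simp
    qed (simp add: v_on_plane)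
  qed
  have lapv: "\<exists>l. has_lap (v e \<mu>) (\<lambda>x. G x - mirror e 0 (G (mirror e \<mu> x))) l x \<and> l \<le> L * v e \<mu> x"
    if "x \<bullet> e \<ge> \<mu>" for x
    using has_lap_v[OF e] Lip[of x "mirror e \<mu> x"] P\<mu> that
    by (fastforce simp: P_def v_def)
  show ?thesis
  proof (cases "\<exists>z. z \<bullet> e > \<mu> \<and> v e \<mu> z = 0")
    case True
    then obtain z where z: "z \<bullet> e > \<mu>" "v e \<mu> z = 0" by blast
    have "v e \<mu> x = 0" if "x \<bullet> e \<ge> \<mu>" for x
    proof (cases "x \<bullet> e = \<mu>")
      case False
      show ?thesis
      proof (rule strong_maximum_principle[where S = "{x. x \<bullet> e > \<mu>}" and v = "v e \<mu>" and z = z, OF _ _ L])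
        show "open {x. x \<bullet> e > \<mu>}" by (intro open_Collect_less continuous_intros)
        have "convex {x. x \<bullet> e > \<mu>}" using convex_halfspace_gt[of \<mu> e] by (simp add: inner_commute)
        then show "connected {x. x \<bullet> e > \<mu>}" by (rule convex_connected)
        show "\<exists>l. has_lap (v e \<mu>) (\<lambda>x. G x - mirror e 0 (G (mirror e \<mu> x))) l y \<and> l \<le> L * v e \<mu> y"
          if "y \<in> {x. x \<bullet> e > \<mu>}" for y using that by (intro lapv) simp
      qed (use P\<mu> z that False in \<open>auto simp: P_def\<close>)
    qed (simp add: v_on_plane)
    then show ?thesis by blast
  next
    case False
    then have pos: "v e \<mu> x > 0" if "x \<bullet> e > \<mu>" for x
      using that P\<mu> unfolding P_def by (metis less_eq_real_def)
    \<comment> \<open>By \<open>v_nonneg_from_ball\<close> a failing plane already fails inside the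
      fixed ball of radius \<open>R0\<close>; this is the compactness that lets the violations
      converge.\<close>
    have "\<exists>m x. \<mu> - 1 / Suc k \<le> m \<and> m < \<mu> \<and> x \<bullet> e \<ge> m \<and> norm x \<le> R0 \<and> v e m x < 0" for k
    proof -
      have "\<mu> - 1 / Suc k \<notin> A" using cInf_lower[OF _ bdd, of "\<mu> - 1 / Suc k"] by (auto simp: \<mu>_def)
      then obtain m where m: "\<mu> - 1 / Suc k \<le> m" "\<not> P m" by (auto simp: A_def)
      moreover have "m < \<mu>" using m(2) above P\<mu> by (metis linorder_neqE)
      moreover obtain x where "x \<bullet> e \<ge> m" "norm x \<le> R0" "v e m x < 0"
        using m(2) v_nonneg_from_ball[OF e, of m] unfolding P_def by (meson not_less)
      ultimately show ?thesis by blast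
    qed
    then obtain M X where MX: "\<And>k. \<mu> - 1 / Suc k \<le> M k" "\<And>k. M k < \<mu>" "\<And>k. X k \<bullet> e \<ge> M k"
      "\<And>k. norm (X k) \<le> R0" "\<And>k. v e (M k) (X k) < 0" by metis
    have Mlim: "M \<longlonglongrightarrow> \<mu>"
    proof (rule tendsto_sandwich[OF _ _ _ tendsto_const[of \<mu>]])
      show "(\<lambda>k. \<mu> - 1 / Suc k) \<longlonglongrightarrow> \<mu>"
        using tendsto_diff[OF tendsto_const LIMSEQ_Suc[OF lim_1_over_n[where ?'a = real]], of \<mu>] by simp
      show "\<forall>\<^sub>F k in sequentially. \<mu> - 1 / Suc k \<le> M k" using MX(1) by simp
      show "\<forall>\<^sub>F k in sequentially. M k \<le> \<mu>" by (intro always_eventually allI less_imp_le MX(2))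
    qed
    have "seq_compact (cball (0::'a) R0)" using compact_cball compact_eq_seq_compact_metric by blast
    then obtain x s where s: "strict_mono s" "(X \<circ> s) \<longlonglongrightarrow> x" "norm x \<le> R0"
      using MX(4) unfolding seq_compact_def by (metis mem_cball_0)
    define Y where "Y k = mirror e (M k) (X k)" for k
    have Ms: "(\<lambda>k. M (s k)) \<longlonglongrightarrow> \<mu>" using LIMSEQ_subseq_LIMSEQ[OF Mlim s(1)] by (simp add: o_def)
    have Xs: "(\<lambda>k. X (s k)) \<longlonglongrightarrow> x" using s(2) by (simp add: o_def)
    have Ys: "(\<lambda>k. Y (s k)) \<longlonglongrightarrow> mirror e \<mu> x"
      unfolding Y_def mirror_def by (intro tendsto_intros Ms Xs)
    have ucont: "isCont u y" for y using has_lapD(2)[OF lapu] .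
    have "x \<bullet> e \<ge> \<mu>"
      using MX(3) by (intro LIMSEQ_le[OF Ms tendsto_inner[OF Xs tendsto_const]]) auto
    moreover have "u x \<le> u (mirror e \<mu> x)"
      using MX(5) by (intro LIMSEQ_le[OF isCont_tendsto_compose[OF ucont Xs] isCont_tendsto_compose[OF ucont Ys]])
        (auto simp: v_def Y_def intro: less_imp_le)
    \<comment> \<open>Beyond the plane \<open>v\<close> is strictly positive, so the limit of the
      violations can only lie on the plane itself.\<close>
    ultimately have x: "x \<bullet> e = \<mu>" using pos[of x] by (force simp: v_def)
    \<comment> \<open>Mean value theorem: \<open>u\<close> is smaller at \<open>X k\<close> than at
      its mirror image, and the segment between them is parallel to \<open>e\<close>. These segments
      shrink to \<open>x\<close>, so the slope along \<open>e\<close> at \<open>x\<close> is at most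
      0.\<close>
    have "\<exists>\<xi>. \<xi> \<in> closed_segment (Y k) (X k) \<and> G \<xi> \<bullet> e < 0" for k
    proof -
      define t where "t = 2 * (X k \<bullet> e - M k)"
      have t: "t > 0" using MX(3)[of k] MX(5)[of k] v_on_plane[of "X k" e "M k"] by (force simp: t_def)
      have XY: "X k = Y k + t *\<^sub>R e" by (simp add: Y_def mirror_def t_def)
      have der: "((\<lambda>r. u (Y k + r *\<^sub>R e)) has_real_derivative (G (Y k + h *\<^sub>R e) \<bullet> e)) (at h)" for h
      proof -
        have "((\<lambda>r. u (Y k + r *\<^sub>R e)) has_derivative (\<lambda>r. G (Y k + h *\<^sub>R e) \<bullet> (r *\<^sub>R e))) (at h)"
          by (rule has_derivative_compose[where f = "\<lambda>r. Y k + r *\<^sub>R e" and g = u])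
             (auto intro!: derivative_eq_intros has_lapD(1)[OF lapu])
        then show ?thesis by (simp add: has_field_derivative_def mult_commute_abs)
      qed
      obtain h where h: "0 < h" "h < t" "u (Y k + t *\<^sub>R e) - u (Y k + 0 *\<^sub>R e) = (t - 0) * (G (Y k + h *\<^sub>R e) \<bullet> e)"
        using MVT2[OF t, of "\<lambda>r. u (Y k + r *\<^sub>R e)" "\<lambda>h. G (Y k + h *\<^sub>R e) \<bullet> e"] der by blast
      have "u (X k) - u (Y k) < 0" using MX(5)[of k] by (simp add: v_def Y_def)
      then have "t * (G (Y k + h *\<^sub>R e) \<bullet> e) < 0" using h(3) XY by simp
      then have "G (Y k + h *\<^sub>R e) \<bullet> e < 0" using t by (simp add: mult_less_0_iff)
      moreover have "Y k + h *\<^sub>R e \<in> closed_segment (Y k) (X k)"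
        unfolding in_segment XY using h t
        by (intro exI[of _ "h / t"]) (auto simp: algebra_simps)
      ultimately show ?thesis by blast
    qed
    then obtain Z where Z: "\<And>k. Z k \<in> closed_segment (Y k) (X k)" "\<And>k. G (Z k) \<bullet> e < 0" by metis
    have "(\<lambda>k. Z (s k)) \<longlonglongrightarrow> x"
    proof -
      have "(\<lambda>k. norm (Z (s k) - X (s k))) \<longlonglongrightarrow> 0"
      proof (rule tendsto_sandwich[OF _ _ tendsto_const])
        show "(\<lambda>k. norm (Y (s k) - X (s k))) \<longlonglongrightarrow> 0"
          using tendsto_norm[OF tendsto_diff[OF Ys Xs]] x by (simp add: mirror_on_plane)
        show "\<forall>\<^sub>F k in sequentially. norm (Z (s k) - X (s k)) \<le> norm (Y (s k) - X (s k))"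
          using segment_bound(2)[OF Z(1)] by (simp add: norm_minus_commute)
      qed simp
      then show ?thesis using tendsto_add[OF tendsto_norm_zero_cancel Xs, of "\<lambda>k. Z (s k) - X (s k)"] by simp
    qed
    then have "(\<lambda>k. G (Z (s k)) \<bullet> e) \<longlonglongrightarrow> G x \<bullet> e"
      by (intro tendsto_inner tendsto_const isCont_tendsto_compose[OF has_lapD(3)[OF lapu]])
    then have le: "G x \<bullet> e \<le> 0"
      using Z(2) by (intro LIMSEQ_le_const2) (auto intro: less_imp_le)
    have half: "y \<bullet> e \<ge> \<mu>" "y \<in> ball (x + e) 1 \<Longrightarrow> y \<bullet> e > \<mu>" if "y \<in> cball (x + e) 1" for y
    proof -
      have "x \<bullet> e + 1 - y \<bullet> e = (x + e - y) \<bullet> e" by (simp add: inner_diff_left inner_add_left ee)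
      also have "\<dots> \<le> norm (x + e - y)" by (rule xe)
      finally show "y \<bullet> e \<ge> \<mu>" "y \<in> ball (x + e) 1 \<Longrightarrow> y \<bullet> e > \<mu>" using that x by (auto simp: dist_norm)
    qed
    \<comment> \<open>The unit ball about \<open>x + e\<close> touches the plane from inside at
      \<open>x\<close>. On the plane the slope of \<open>v\<close> along \<open>e\<close> is twice
      that of \<open>u\<close>.\<close>
    have "(G x - mirror e 0 (G (mirror e \<mu> x))) \<bullet> (x + e - x) > 0"
    proof (rule hopf_ball[OF _ L, of 1 "x + e" "v e \<mu>"])
      show "0 \<le> v e \<mu> y" if "y \<in> cball (x + e) 1" for y using P\<mu> half(1)[OF that] by (simp add: P_def)
      show "0 < v e \<mu> y" if "y \<in> ball (x + e) 1" for y using that half(2)[of y] by (intro pos) auto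
      show "\<exists>l. has_lap (v e \<mu>) (\<lambda>x. G x - mirror e 0 (G (mirror e \<mu> x))) l y \<and> l \<le> L * v e \<mu> y"
        if "y \<in> ball (x + e) 1" for y using that half(1)[of y] by (intro lapv) auto
      show "continuous_on (cball (x + e) 1) (v e \<mu>)" by (rule continuous_v[OF e])
      show "norm (x - (x + e)) = 1" using e by simp
      show "v e \<mu> x = 0" using x by (rule v_on_plane)
      show "(v e \<mu> has_derivative (\<lambda>h. (G x - mirror e 0 (G (mirror e \<mu> x))) \<bullet> h)) (at x)"
        by (rule has_lapD(1)[OF has_lap_v[OF e]])
    qed simp
    then have "G x \<bullet> e > 0"
      unfolding mirror_on_plane[OF x] by (simp add: mirror_def[of e 0] inner_diff_left ee)
    then show ?thesis using le by simp
  qed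
qed

theorem radially_symmetric: "radially_symmetric u"
proof (rule radially_symmetric_if_mirror_symmetric[OF _ lim])
  show "u x \<noteq> b" for x using ub[of x] by simp
  fix e :: 'a assume e: "norm e = 1"
  then obtain m where m: "\<And>x. x \<bullet> e \<ge> m \<Longrightarrow> v e m x = 0" using moving_plane_stops by blast
  have "u (mirror e m x) = u x" for x
  proof (cases "x \<bullet> e \<ge> m")
    case False
    then have "mirror e m x \<bullet> e \<ge> m" using e by (simp add: mirror_def inner_diff_left norm_eq_1)
    from m[OF this] show ?thesis using e by (simp add: v_def mirror_mirror)
  qed (use m in \<open>simp add: v_def\<close>)
  then show "\<exists>m. \<forall>x. u (mirror e m x) = u x" by blast
qed

end

section \<open>Comparison functions\<close>

lemma has_lap_norm:
  fixes p :: "'a::euclidean_space"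
  assumes "x \<noteq> p"
  shows "has_lap (\<lambda>y. norm (y - p)) (\<lambda>y. (1 / norm (y - p)) *\<^sub>R (y - p)) ((real DIM('a) - 1) / norm (x - p)) x"
proof -
  let ?s = "(norm (x - p))\<^sup>2"
  have s: "?s > 0" using assms by simp
  have "has_lap (\<lambda>y. sqrt ((norm (y - p))\<^sup>2)) (\<lambda>y. (1 / (2 * sqrt ((norm (y - p))\<^sup>2))) *\<^sub>R (2 *\<^sub>R (y - p)))
     (- 1 / (4 * ?s * sqrt ?s) * (norm (2 *\<^sub>R (x - p)))\<^sup>2 + 1 / (2 * sqrt ?s) * (2 * real DIM('a))) x"
  proof (rule has_lap_compose[OF has_lap_sqdist, where \<phi> = sqrt and \<phi>' = "\<lambda>t. 1 / (2 * sqrt t)"])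
    have "(sqrt has_real_derivative 1 / (2 * sqrt t)) (at t)" if "t > 0" for t
      using that by (auto intro!: derivative_eq_intros simp: field_simps)
    then show "\<forall>\<^sub>F t in nhds ?s. (sqrt has_real_derivative 1 / (2 * sqrt t)) (at t)"
      using eventually_nhds_in_open[of "{0<..}" ?s] s by (auto elim!: eventually_mono)
    show "((\<lambda>t. 1 / (2 * sqrt t)) has_real_derivative - 1 / (4 * ?s * sqrt ?s)) (at ?s)"
      using s by (auto intro!: derivative_eq_intros simp: field_simps power2_eq_square)
  qed
  moreover have "- 1 / (4 * ?s * sqrt ?s) * (norm (2 *\<^sub>R (x - p)))\<^sup>2 + 1 / (2 * sqrt ?s) * (2 * real DIM('a))
      = (real DIM('a) - 1) / norm (x - p)"
    using s unfolding norm_scaleR by (simp add: field_simps power2_eq_square)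
  ultimately show ?thesis by simp
qed

text \<open>This is |x| to the power \<open>2 * \<kappa>\<close>, written through the squared norm
  so that the chain rule applies to \<open>has_lap_sqdist\<close>.\<close>

definition rad :: "real \<Rightarrow> 'a::euclidean_space \<Rightarrow> real" where
  "rad \<kappa> x = (norm x)\<^sup>2 powr \<kappa>"

text \<open>The factor \<open>2 * \<kappa> - 2 + real DIM('a)\<close> decides the sign of the
  Laplacian; it vanishes for the fundamental solution,
  \<open>\<kappa> = 1 - real DIM('a) / 2\<close>.\<close>

lemma has_lap_rad:
  fixes x :: "'a::euclidean_space"
  assumes "x \<noteq> 0"
  shows "has_lap (rad \<kappa>) (\<lambda>y. (\<kappa> * rad (\<kappa> - 1) y) *\<^sub>R (2 *\<^sub>R y))
    (2 * \<kappa> * (2 * \<kappa> - 2 + real DIM('a)) * rad (\<kappa> - 1) x) x"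
proof -
  let ?s = "(norm x)\<^sup>2"
  have s: "?s > 0" using assms by simp
  have "has_lap (\<lambda>y. (norm (y - 0))\<^sup>2 powr \<kappa>) (\<lambda>y. (\<kappa> * (norm (y - 0))\<^sup>2 powr (\<kappa> - 1)) *\<^sub>R (2 *\<^sub>R (y - 0)))
     (\<kappa> * ((\<kappa> - 1) * ?s powr (\<kappa> - 1 - 1)) * (norm (2 *\<^sub>R (x - 0)))\<^sup>2
      + (\<kappa> * (norm (x - 0))\<^sup>2 powr (\<kappa> - 1)) * (2 * real DIM('a))) x"
  proof (rule has_lap_compose[OF has_lap_sqdist, where \<phi> = "\<lambda>t. t powr \<kappa>" and \<phi>' = "\<lambda>t. \<kappa> * t powr (\<kappa> - 1)"])
    have "((\<lambda>t. t powr \<kappa>) has_real_derivative \<kappa> * t powr (\<kappa> - 1)) (at t)" if "t > 0" for t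
      using that by (rule has_real_derivative_powr)
    then show "\<forall>\<^sub>F t in nhds ((norm (x - 0))\<^sup>2). ((\<lambda>t. t powr \<kappa>) has_real_derivative \<kappa> * t powr (\<kappa> - 1)) (at t)"
      using eventually_nhds_in_open[of "{0<..}" "?s"] s by (auto elim!: eventually_mono)
    show "((\<lambda>t. \<kappa> * t powr (\<kappa> - 1)) has_real_derivative \<kappa> * ((\<kappa> - 1) * ?s powr (\<kappa> - 1 - 1))) (at ((norm (x - 0))\<^sup>2))"
      using DERIV_cmult[OF has_real_derivative_powr[OF s, of "\<kappa> - 1"], of \<kappa>] by simp
  qed
  moreover have "?s powr (\<kappa> - 1) = ?s powr (\<kappa> - 1 - 1) * ?s"
    using s powr_add[of ?s "\<kappa> - 1 - 1" 1] by simp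
  ultimately show ?thesis
    unfolding rad_def[abs_def] norm_scaleR by (simp add: algebra_simps power_mult_distrib)
qed

lemma rad_pos: "x \<noteq> 0 \<Longrightarrow> rad \<kappa> x > 0"
  by (simp add: rad_def)

lemma rad_add: "rad (\<kappa> + \<kappa>') x = rad \<kappa> x * rad \<kappa>' x"
  by (simp add: rad_def powr_add)

lemma rad_mono: "norm x \<ge> 1 \<Longrightarrow> \<kappa> \<le> \<kappa>' \<Longrightarrow> rad \<kappa> x \<le> rad \<kappa>' x"
  unfolding rad_def by (intro powr_mono) auto

lemma rad_tendsto_0:
  assumes "\<kappa> < 0"
  shows "(rad \<kappa> \<longlongrightarrow> 0) (at_infinity :: 'a::euclidean_space filter)"
proof -
  have "filterlim (\<lambda>x::'a. (norm x)\<^sup>2) at_top at_infinity"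
    by (intro filterlim_pow_at_top filterlim_norm_at_top) simp
  then show ?thesis unfolding rad_def[abs_def] using assms by (intro tendsto_neg_powr)
qed

text \<open>Comparison with a multiple of the fundamental solution, which tends to 0 at infinity in
  dimension at least 3. The difference is strictly subharmonic, at most 0 on the inner sphere and
  tends to 0, so it has no positive maximum.\<close>

lemma exterior_decay:
  fixes w :: "'a::euclidean_space \<Rightarrow> real"
  assumes R: "R > 0" and lap: "\<And>x. norm x \<ge> R \<Longrightarrow> has_lap w G (l x) x"
    and sub: "\<And>x. norm x \<ge> R \<Longrightarrow> l x > 0"
    and lim: "(w \<longlongrightarrow> 0) at_infinity" and dim: "DIM('a) \<ge> 3"
  shows "\<exists>C>0. \<forall>x. norm x \<ge> R \<longrightarrow> w x \<le> C * rad (1 - real DIM('a) / 2) x"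
proof -
  define \<kappa> where "\<kappa> = 1 - real DIM('a) / 2"
  have \<kappa>: "\<kappa> < 0" "2 * \<kappa> - 2 + real DIM('a) = 0" using dim by (auto simp: \<kappa>_def)
  have cw: "continuous_on {x. norm x \<ge> R} w"
    using lap has_lapD(2) by (intro continuous_at_imp_continuous_on) blast
  have "compact (w ` sphere 0 R)"
    by (intro compact_continuous_image continuous_on_subset[OF cw]) auto
  then obtain B where B: "\<And>x. norm x = R \<Longrightarrow> \<bar>w x\<bar> \<le> B" "B > 0"
    using compact_imp_bounded bounded_pos by (metis image_eqI mem_sphere_0 real_norm_def)
  \<comment> \<open>On the sphere of radius \<open>R\<close> the comparison function equals
    \<open>B\<close>.\<close>
  define C where "C = B / R\<^sup>2 powr \<kappa>"
  have C: "C > 0" using B R by (simp add: C_def)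
  define d where "d x = w x - C * rad \<kappa> x" for x
  have lapd: "has_lap d (\<lambda>y. G y - C *\<^sub>R ((\<kappa> * rad (\<kappa> - 1) y) *\<^sub>R (2 *\<^sub>R y))) (l x) x"
    if "norm x \<ge> R" for x
  proof -
    have "x \<noteq> 0" using that R by auto
    from has_lap_diff[OF lap[OF that] has_lap_cmult[OF has_lap_rad[OF this], of C \<kappa>]]
    show ?thesis using \<kappa>(2) by (simp add: d_def[abs_def])
  qed
  have limd: "(d \<longlongrightarrow> 0) at_infinity"
    unfolding d_def[abs_def] using tendsto_diff[OF lim tendsto_mult_left[OF rad_tendsto_0[OF \<kappa>(1)], of C]] by simp
  have "d x \<le> 0" if x: "norm x \<ge> R" for x
  proof (rule ccontr)
    assume dx: "\<not> d x \<le> 0"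
    then have "\<forall>\<^sub>F y in at_infinity. d y < d x" using order_tendstoD(2)[OF limd] by simp
    then obtain r where r: "\<And>y. norm y \<ge> r \<Longrightarrow> d y < d x" unfolding eventually_at_infinity by blast
    let ?K = "{y::'a. norm y \<ge> R} \<inter> cball 0 (max r (norm x))"
    have "compact ?K" by (intro closed_Int_compact closed_Collect_le continuous_intros compact_cball)
    moreover have "continuous_on ?K d"
      using lapd has_lapD(2) by (intro continuous_at_imp_continuous_on) blast
    moreover have xK: "x \<in> ?K" using x by simp
    ultimately obtain z where z: "z \<in> ?K" "\<And>y. y \<in> ?K \<Longrightarrow> d y \<le> d z"
      using continuous_attains_sup[of ?K d] by blast
    have zx: "d x \<le> d z" using z(2)[OF xK] .
    have max: "d y \<le> d z" if "norm y \<ge> R" for y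
    proof (cases "y \<in> ?K")
      case False
      then have "norm y \<ge> r" using that by simp
      then show ?thesis using r[of y] zx by simp
    qed (rule z(2))
    have "norm z \<noteq> R"
    proof
      assume "norm z = R"
      then have "d z \<le> 0" using B(1)[of z] R by (simp add: d_def C_def rad_def)
      then show False using zx dx by simp
    qed
    then have zR: "norm z > R" using z(1) by simp
    have "\<forall>\<^sub>F y in nhds z. -1 * d z \<le> -1 * d y"
    proof (rule eventually_mono[OF eventually_nhds_in_open[of "{y. norm y > R}"]])
      show "open {y::'a. norm y > R}" by (intro open_Collect_less continuous_intros)
      show "-1 * d z \<le> -1 * d y" if "y \<in> {y. norm y > R}" for y using max[of y] that by simp
    qed (use zR in simp)
    from has_lap_local_min(2)[OF has_lap_cmult[OF lapd] this] show False using zR sub[of z] by simp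
  qed
  then show ?thesis using C by (auto simp: d_def \<kappa>_def)
qed

text \<open>At a critical point of \<open>|x - p| + Q (u x)\<close> the terms coming from \<open>Q (u x)\<close> cancel in the
  Laplacian, which is therefore that of \<open>|x - p|\<close>.\<close>

lemma solution_le:
  fixes u :: "'a::euclidean_space \<Rightarrow> real"
  assumes dim: "DIM('a) \<ge> 2"
    and W: "\<And>t. (W has_real_derivative f t) (at t)"
    and lap: "\<And>x. has_lap u G (f (u x)) x"
    and quad: "\<And>M. \<exists>K>0. \<forall>s\<in>{b..M}. W s - W b \<le> K * (s - b)\<^sup>2"
    and ge: "\<And>s. s > b \<Longrightarrow> W s \<ge> W b"
    and R: "R > 0" "\<And>x. norm x \<ge> R \<Longrightarrow> u x < b"
  shows "u y \<le> b"
proof (rule ccontr)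
  assume "\<not> u y \<le> b"
  define M where "M = u y"
  have M: "M > b" using \<open>\<not> u y \<le> b\<close> by (simp add: M_def)
  obtain K where K: "K > 0" "\<And>s. b \<le> s \<Longrightarrow> s \<le> M \<Longrightarrow> W s - W b \<le> K * (s - b)\<^sup>2" using quad[of M] by auto
  \<comment> \<open>Then \<open>P t\<close> is at most
    \<open>(k * (t - b))\<^sup>2 + \<eta>\<^sup>2\<close> for \<open>t\<close> between
    \<open>b\<close> and \<open>M\<close>, and \<open>Q\<close> grows at least like a logarithm
    there.\<close>
  define k where "k = sqrt (2 * K)"
  have k: "k > 0" "k\<^sup>2 = 2 * K" using K by (auto simp: k_def)
  \<comment> \<open>Makes \<open>(k * (M - b) + \<eta>) / \<eta>\<close> equal to
    \<open>exp (k * (3 * R)) + 1\<close>, whose logarithm divided by \<open>k\<close> exceeds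
    \<open>3 * R\<close>.\<close>
  define \<eta> where "\<eta> = k * (M - b) / exp (k * (3 * R))"
  have \<eta>: "\<eta> > 0" using k M by (simp add: \<eta>_def)
  \<comment> \<open>\<open>P\<close> is the squared slope of a one-dimensional solution as a
    function of its value, and \<open>q\<close> is the derivative of the inverse profile. The term
    \<open>\<eta>\<^sup>2\<close> keeps \<open>P\<close> positive at \<open>b\<close>.\<close>
  define P where "P s = 2 * (W s - W b) + \<eta>\<^sup>2" for s
  have P: "P s > 0" if "s \<ge> b" for s
    using that ge[of s] \<eta> by (cases "s = b") (auto simp: P_def intro!: add_nonneg_pos)
  define q where "q s = 1 / sqrt (P s)" for s
  have q0: "q s > 0" if "s \<ge> b" for s using P[OF that] by (simp add: q_def)
  have Wc: "continuous_on S W" for S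
    using W DERIV_isCont by (blast intro: continuous_at_imp_continuous_on)
  have qc: "continuous_on {b..c} q" for c
    unfolding q_def P_def
    by (intro continuous_intros Wc) (use P in \<open>force simp: P_def\<close>)
  define Q where "Q t = integral {b..t} q" for t
  have Qc: "continuous_on {b..c} Q" for c
    unfolding Q_def by (intro indefinite_integral_continuous_1 integrable_continuous_interval qc)
  have Qd: "(Q has_real_derivative q t) (at t)" if "t > b" for t
  proof -
    have "(Q has_real_derivative q t) (at t within {b..t+1})"
      unfolding Q_def using that by (intro integral_has_real_derivative qc) auto
    moreover have "at t within {b..t+1} = at t" using that by (intro at_within_interior) auto
    ultimately show ?thesis by simp
  qed
  have qd: "(q has_real_derivative - (f t * q t ^ 3)) (at t)" if "t \<ge> b" for t
  proof -
    have "(P has_real_derivative 2 * f t) (at t)"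
      unfolding P_def by (auto intro!: derivative_eq_intros W)
    then show ?thesis
      unfolding q_def using P[OF that]
      by (auto intro!: derivative_eq_intros simp: field_simps power2_eq_square power3_eq_cube)
  qed
  have Qlarge: "Q M > 3 * R"
  proof -
    define D where "D t = Q t - ln (k * (t - b) + \<eta>) / k" for t
    have arg: "k * (t - b) + \<eta> > 0" if "t \<ge> b" for t using that k \<eta> by (intro add_nonneg_pos) auto
    have "D b < D M"
    proof (rule DERIV_pos_imp_increasing_open[of b M D])
      show "b < M" using M .
      fix t assume t: "b < t" "t < M"
      have "(D has_real_derivative q t - 1 / (k * (t - b) + \<eta>)) (at t)"
      proof -
        have "((\<lambda>t. ln (k * (t - b) + \<eta>)) has_real_derivative k / (k * (t - b) + \<eta>)) (at t)"
          using t arg[of t] by (auto intro!: derivative_eq_intros)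
        from DERIV_diff[OF Qd[OF t(1)] DERIV_cdivide[OF this, of k]] show ?thesis
          using k by (simp add: D_def[abs_def])
      qed
      moreover have "q t > 1 / (k * (t - b) + \<eta>)"
      proof -
        have "P t \<le> 2 * (K * (t - b)\<^sup>2) + \<eta>\<^sup>2" using K(2)[of t] t by (simp add: P_def)
        also have "\<dots> = (k * (t - b))\<^sup>2 + \<eta>\<^sup>2" using k by (simp add: power_mult_distrib)
        also have "\<dots> < (k * (t - b) + \<eta>)\<^sup>2"
          using k \<eta> t by (simp add: power2_sum)
        finally have "sqrt (P t) < k * (t - b) + \<eta>"
          using arg[of t] t by (intro real_less_lsqrt) auto
        then show ?thesis unfolding q_def using P[of t] arg[of t] t
          by (intro divide_strict_left_mono mult_pos_pos) auto
      qed
      ultimately show "\<exists>y. (D has_real_derivative y) (at t) \<and> y > 0" by force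
    next
      show "continuous_on {b..M} D"
        unfolding D_def using arg k
        by (intro continuous_intros continuous_on_subset[OF Qc]) (auto simp: less_imp_neq[symmetric])
    qed
    then have "Q M \<ge> (ln (k * (M - b) + \<eta>) - ln \<eta>) / k"
      by (simp add: D_def Q_def diff_divide_distrib)
    also have "ln (k * (M - b) + \<eta>) - ln \<eta> = ln ((k * (M - b) + \<eta>) / \<eta>)"
      using arg[of M] M \<eta> by (simp add: ln_div)
    also have "(k * (M - b) + \<eta>) / \<eta> = exp (k * (3 * R)) + 1"
      using \<eta> k M by (simp add: \<eta>_def field_simps)
    finally have "Q M \<ge> ln (exp (k * (3 * R)) + 1) / k" .
    moreover have "ln (exp (k * (3 * R)) + 1) > k * (3 * R)"
      by (metis add_pos_pos exp_gt_zero less_add_one ln_exp ln_less_cancel_iff zero_less_one)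
    then have "3 * R < ln (exp (k * (3 * R)) + 1) / k"
      using k(1) by (simp add: pos_less_divide_eq mult.commute)
    ultimately show ?thesis by linarith
  qed
  obtain e0 :: 'a where e0: "e0 \<in> Basis" using nonempty_Basis by blast
  \<comment> \<open>Outside the ball of radius \<open>R\<close>, so that the distance to
    \<open>p\<close> is smooth near \<open>?S\<close>, and close enough for that distance to be at
    most \<open>3 * R\<close> on \<open>?S\<close>. A maximum point with \<open>u z = b\<close>
    would thus have too small a value of \<open>F\<close>.\<close>
  define p where "p = (2 * R) *\<^sub>R e0"
  have np: "norm p = 2 * R" using e0 R by (simp add: p_def)
  let ?S = "{x. u x \<ge> b}"
  have SR: "norm x < R" if "x \<in> ?S" for x using that R(2)[of x] by force
  have uc: "continuous_on UNIV u" using has_lapD(2)[OF lap] by (simp add: continuous_at_imp_continuous_on)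
  have "closed ?S" using uc by (intro closed_Collect_le) auto
  moreover have "bounded ?S" using SR by (intro boundedI[of _ R]) (auto intro: less_imp_le)
  ultimately have "compact ?S" by (simp add: compact_eq_bounded_closed)
  define F where "F x = norm (x - p) + Q (u x)" for x
  have yS: "y \<in> ?S" using M by (simp add: M_def)
  then obtain c where c: "\<And>x. x \<in> ?S \<Longrightarrow> u x \<le> c"
    using continuous_attains_sup[OF \<open>compact ?S\<close> _ continuous_on_subset[OF uc]] by blast
  have "continuous_on ?S F"
    unfolding F_def
    by (intro continuous_intros continuous_on_compose2[OF Qc[of c] continuous_on_subset[OF uc]]) (use c in auto)
  then obtain z where z: "z \<in> ?S" "\<And>x. x \<in> ?S \<Longrightarrow> F x \<le> F z"
    using continuous_attains_sup[OF \<open>compact ?S\<close>, of F] yS by blast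
  have zp: "norm (z - p) \<le> 3 * R" "norm (z - p) > 0"
    using norm_triangle_ineq4[of z p] norm_triangle_ineq2[of p z] SR[OF z(1)] np R
    by (auto simp: norm_minus_commute)
  consider "u z = b" | "u z > b" using z(1) by force
  then show False
  proof cases
    case 1
    then have "F z \<le> 3 * R" using zp by (simp add: F_def Q_def)
    moreover have "F y \<ge> Q M" by (simp add: F_def M_def)
    ultimately show False using z(2)[OF yS] Qlarge by simp
  next
    case 2
    have ev: "\<forall>\<^sub>F x in nhds z. u x > b"
    proof -
      have "open {x. u x > b}" using uc by (intro open_Collect_less) auto
      from eventually_nhds_in_open[OF this, of z] 2 show ?thesis by simp
    qed
    have "has_lap (\<lambda>x. Q (u x)) (\<lambda>x. q (u x) *\<^sub>R G x)
       (- (f (u z) * q (u z) ^ 3) * (norm (G z))\<^sup>2 + q (u z) * f (u z)) z"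
    proof (rule has_lap_compose[OF lap])
      show "\<forall>\<^sub>F t in nhds (u z). (Q has_real_derivative q t) (at t)"
        using eventually_nhds_in_open[of "{b<..}" "u z"] 2 by (auto elim!: eventually_mono intro: Qd)
      show "(q has_real_derivative - (f (u z) * q (u z) ^ 3)) (at (u z))" using 2 by (intro qd) simp
    qed
    from has_lap_cmult[OF has_lap_add[OF has_lap_norm this], of p "-1"] zp(2)
    have lapF: "has_lap (\<lambda>x. -1 * F x) (\<lambda>x. -1 *\<^sub>R ((1 / norm (x - p)) *\<^sub>R (x - p) + q (u x) *\<^sub>R G x))
      (-1 * ((real DIM('a) - 1) / norm (z - p) + (- (f (u z) * q (u z) ^ 3) * (norm (G z))\<^sup>2 + q (u z) * f (u z)))) z"
      unfolding F_def by auto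
    have min: "\<forall>\<^sub>F x in nhds z. -1 * F z \<le> -1 * F x"
      using ev
    proof eventually_elim
      case (elim x)
      then show ?case using z(2)[of x] by simp
    qed
    \<comment> \<open>The gradient of the distance has norm one, hence so has that of
      \<open>Q (u x)\<close> at the critical point; this is what makes the terms with
      \<open>f\<close> cancel.\<close>
    have "(1 / norm (z - p)) *\<^sub>R (z - p) + q (u z) *\<^sub>R G z = 0"
      using has_lap_local_min(1)[OF lapF min] by (metis neg_equal_0_iff_equal scaleR_minus1_left)
    then have "q (u z) *\<^sub>R G z = - ((1 / norm (z - p)) *\<^sub>R (z - p))"
      by (metis add_eq_0_iff)
    then have "norm (q (u z) *\<^sub>R G z) = 1" using zp(2) by simp
    then have "q (u z) * norm (G z) = 1" using q0[of "u z"] 2 by simp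
    then have "q (u z) ^ 3 * (norm (G z))\<^sup>2 = q (u z)"
      by (simp add: power2_eq_square power3_eq_cube mult.assoc[symmetric])
    then have cancel: "- (f (u z) * q (u z) ^ 3) * (norm (G z))\<^sup>2 + q (u z) * f (u z) = 0"
      by (simp add: mult.assoc)
    have "(real DIM('a) - 1) / norm (z - p) \<le> 0"
      using has_lap_local_min(2)[OF lapF min]
      by (simp only: cancel add_0_right mult_minus1 neg_0_le_iff_le)
    then show False using dim zp(2) by (simp add: field_simps)
  qed
qed

section \<open>The behaviour of the potential near \<open>b\<close>\<close>

text \<open>The first nonzero coefficient decides the sign near 0, and a cubic perturbation cannot
  undo a negative one. If all three vanish, the first alternative holds.\<close>

lemma cubic_sign_alternative:
  fixes c0 c1 c2 B :: real
  shows "(\<forall>\<^sub>F s in at_right 0. c0 + c1 * s + c2 * s\<^sup>2 \<ge> 0) \<or>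
    (\<forall>\<^sub>F s in at_right 0. c0 + c1 * s + c2 * s\<^sup>2 + B * s ^ 3 < 0)"
proof -
  have spos: "\<forall>\<^sub>F s::real in at_right 0. s > 0" by (rule eventually_at_right_less)
  have 0: "((\<lambda>s. c0 + c1 * s + c2 * s\<^sup>2) \<longlongrightarrow> c0) (at_right 0)" for c0 c1 c2 :: real
    by (auto intro!: tendsto_eq_intros)
  have 1: "((\<lambda>s. c0 + c1 * s + c2 * s\<^sup>2 + B * s ^ 3) \<longlongrightarrow> c0) (at_right 0)" for c0 c1 c2 B :: real
    by (auto intro!: tendsto_eq_intros)
  note p = order_tendstoD(1)[OF 0, of 0] and n = order_tendstoD(2)[OF 1, of _ 0]
  consider "c0 > 0" | "c0 < 0" | "c0 = 0" "c1 > 0" | "c0 = 0" "c1 < 0" | "c0 = 0" "c1 = 0" "c2 \<ge> 0" | "c0 = 0" "c1 = 0" "c2 < 0"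
    by linarith
  then show ?thesis
  proof cases
    case 1
    from p[OF this, of c1 c2] show ?thesis by (intro disjI1) (auto elim!: eventually_mono)
  next
    case 2
    from n[OF this] show ?thesis by blast
  next
    case 3
    from p[OF this(2), of c2 0] spos have "\<forall>\<^sub>F s in at_right 0. c0 + c1 * s + c2 * s\<^sup>2 \<ge> 0"
    proof eventually_elim
      case (elim s)
      then have "s * (c1 + c2 * s) > 0" by simp
      then show ?case using 3 by (simp add: power2_eq_square algebra_simps)
    qed
    then show ?thesis by blast
  next
    case 4
    from n[OF this(2), of c2 B 0] spos have "\<forall>\<^sub>F s in at_right 0. c0 + c1 * s + c2 * s\<^sup>2 + B * s ^ 3 < 0"
    proof eventually_elim
      case (elim s)
      then have "s * (c1 + c2 * s + B * s\<^sup>2) < 0" by (simp add: mult_pos_neg)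
      then show ?case using 4 by (simp add: power2_eq_square power3_eq_cube algebra_simps)
    qed
    then show ?thesis by blast
  next
    case 5
    then show ?thesis by simp
  next
    case 6
    from n[OF this(3), of B 0 0] spos have "\<forall>\<^sub>F s in at_right 0. c0 + c1 * s + c2 * s\<^sup>2 + B * s ^ 3 < 0"
    proof eventually_elim
      case (elim s)
      then have "s\<^sup>2 * (c2 + B * s) < 0" by (simp add: mult_pos_neg)
      then show ?case using 6 by (simp add: power2_eq_square power3_eq_cube algebra_simps)
    qed
    then show ?thesis by blast
  qed
qed

text \<open>\<open>D m\<close> plays the role of the m-th derivative of the potential. If the
  quadratic Taylor polynomial of \<open>D 2\<close> is nonnegative near \<open>b\<close>, the
  remainder gives the cubic bound. Otherwise \<open>D 2\<close> is negative left of
  \<open>b\<close>, so \<open>D 1\<close> decreases to \<open>D 1 b = 0\<close> and is positive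
  there, contrary to \<open>neg\<close>.\<close>

lemma deriv2_lower_bound:
  fixes D :: "nat \<Rightarrow> real \<Rightarrow> real"
  assumes \<delta>: "\<delta> > 0"
    and D: "\<And>m t. m \<le> 4 \<Longrightarrow> b - \<delta> < t \<Longrightarrow> t < b + \<delta> \<Longrightarrow> (D m has_real_derivative D (Suc m) t) (at t)"
    and D5: "isCont (D 5) b"
    and Db: "D 1 b = 0" and ab: "a < b" and neg: "\<And>t. a < t \<Longrightarrow> t < b \<Longrightarrow> D 1 t < 0"
  shows "\<exists>\<eta>>0. \<exists>K\<ge>0. \<forall>t. b - \<eta> < t \<and> t < b \<longrightarrow> D 2 t \<ge> - (K * (b - t) ^ 3)"
proof -
  define B where "B = \<bar>D 5 b\<bar> + 1"
  have "((\<lambda>t. \<bar>D 5 t\<bar>) \<longlongrightarrow> \<bar>D 5 b\<bar>) (at b)" using D5 by (intro tendsto_rabs) (simp add: isCont_def)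
  from order_tendstoD(2)[OF this, of B]
  obtain r where r: "r > 0" "\<And>t. t \<noteq> b \<Longrightarrow> \<bar>t - b\<bar> < r \<Longrightarrow> \<bar>D 5 t\<bar> < B"
    by (auto simp: B_def eventually_at dist_real_def)
  define \<rho> where "\<rho> = min (min r \<delta>) (b - a)"
  have \<rho>: "\<rho> > 0" "\<rho> \<le> r" "\<rho> \<le> \<delta>" "\<rho> \<le> b - a" using r \<delta> ab by (auto simp: \<rho>_def)
  \<comment> \<open>Taylor polynomial of \<open>D 2\<close> at \<open>b\<close> in the variable
    \<open>s = b - t\<close>, which flips the sign of the odd term.\<close>
  define T where "T s = D 2 b + - D 3 b * s + D 4 b / 2 * s\<^sup>2" for s
  have taylor: "\<bar>D 2 (b - s) - T s\<bar> \<le> B / 6 * s ^ 3" if s: "0 < s" "s < \<rho>" for s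
  proof -
    have "\<exists>t>b - s. t < b \<and> D 2 (b - s) = (\<Sum>m<3. D (2 + m) b / fact m * (b - s - b) ^ m) + D (2 + 3) t / fact 3 * (b - s - b) ^ 3"
      using s \<rho> by (intro Taylor_down[where b = b]) (auto intro!: D)
    then obtain t where t: "t > b - s" "t < b" and
      eq: "D 2 (b - s) = (\<Sum>m<3. D (2 + m) b / fact m * (- s) ^ m) + D 5 t / fact 3 * (- s) ^ 3"
      by auto
    have "D 2 (b - s) - T s = - (D 5 t / 6 * s ^ 3)"
      unfolding eq T_def by (simp add: eval_nat_numeral fact_numeral)
    moreover have "\<bar>D 5 t\<bar> \<le> B" using r(2)[of t] t s \<rho> by auto
    ultimately show ?thesis using s by (simp add: abs_mult mult_right_mono)
  qed
  from cubic_sign_alternative[of "D 2 b" "- D 3 b" "D 4 b / 2" "B / 6"]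
  show ?thesis
  proof
    assume "\<forall>\<^sub>F s in at_right 0. D 2 b + - D 3 b * s + D 4 b / 2 * s\<^sup>2 \<ge> 0"
    then obtain \<eta> where \<eta>: "\<eta> > 0" "\<And>s. 0 < s \<Longrightarrow> s < \<eta> \<Longrightarrow> T s \<ge> 0"
      unfolding eventually_at_right_field T_def by auto
    have "D 2 t \<ge> - (B / 6 * (b - t) ^ 3)" if "b - min \<eta> \<rho> < t" "t < b" for t
    proof -
      have "T (b - t) \<ge> 0" using that by (intro \<eta>) auto
      moreover have "\<bar>D 2 t - T (b - t)\<bar> \<le> B / 6 * (b - t) ^ 3" using taylor[of "b - t"] that by auto
      ultimately show ?thesis by linarith
    qed
    moreover have "min \<eta> \<rho> > 0" using \<eta> \<rho> by simp
    moreover have "B / 6 \<ge> 0" by (simp add: B_def)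
    ultimately show ?thesis by blast
  next
    assume "\<forall>\<^sub>F s in at_right 0. D 2 b + - D 3 b * s + D 4 b / 2 * s\<^sup>2 + B / 6 * s ^ 3 < 0"
    then obtain \<eta> where \<eta>: "\<eta> > 0" "\<And>s. 0 < s \<Longrightarrow> s < \<eta> \<Longrightarrow> T s + B / 6 * s ^ 3 < 0"
      unfolding eventually_at_right_field T_def by auto
    define t where "t = b - min \<eta> \<rho> / 2"
    have t: "t < b" "b - t < \<eta>" "b - t < \<rho>" using \<eta>(1) \<rho>(1) by (auto simp: t_def)
    have "\<exists>z>t. z < b \<and> D 1 b - D 1 t = (b - t) * D 2 z"
    proof (rule MVT2[OF t(1)])
      show "(D 1 has_real_derivative D 2 x) (at x)" if "t \<le> x" "x \<le> b" for x
        using D[of 1 x] that t \<rho> by (auto simp: numeral_2_eq_2)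
    qed
    then obtain z where z: "z > t" "z < b" "D 1 b - D 1 t = (b - t) * D 2 z" by blast
    have "D 2 z < 0"
    proof -
      have "\<bar>D 2 z - T (b - z)\<bar> \<le> B / 6 * (b - z) ^ 3" using taylor[of "b - z"] z t by simp
      moreover have "T (b - z) + B / 6 * (b - z) ^ 3 < 0" using \<eta>(2)[of "b - z"] z t by simp
      ultimately show ?thesis by linarith
    qed
    then have "(b - t) * D 2 z < 0" using t by (simp add: mult_pos_neg)
    moreover have "D 1 t < 0" using t \<rho> by (intro neg) auto
    ultimately show ?thesis using z(3) Db by simp
  qed
qed

section \<open>Regularity classes on the real line\<close>

lemma Ck_alpha_on_Suc_real:
  fixes f :: "real \<Rightarrow> real"
  shows "Ck_alpha_on (Suc k) \<alpha> S f \<longleftrightarrow> (\<forall>x\<in>S. f differentiable (at x)) \<and> Ck_alpha_on k \<alpha> S (deriv f)"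
  by (simp add: partial_deriv_real)

lemma Ck_alpha_on_derivs:
  fixes f :: "real \<Rightarrow> real"
  assumes "Ck_alpha_on k \<alpha> S f" "m < k" "x \<in> S"
  shows "((deriv ^^ m) f has_real_derivative (deriv ^^ Suc m) f x) (at x)"
  using assms
proof (induction m arbitrary: f k)
  case 0
  then obtain k' where "k = Suc k'" by (cases k) auto
  with 0 have "f differentiable (at x)" by (simp add: Ck_alpha_on_Suc_real del: Ck_alpha_on.simps)
  then show ?case by (simp add: DERIV_deriv_iff_real_differentiable)
next
  case (Suc m)
  then obtain k' where k: "k = Suc k'" by (cases k) auto
  with Suc have "Ck_alpha_on k' \<alpha> S (deriv f)" "m < k'" by (simp_all add: Ck_alpha_on_Suc_real del: Ck_alpha_on.simps)
  from Suc.IH[OF this Suc.prems(3)] show ?case by (simp add: funpow_swap1)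
qed

lemma C2_real:
  fixes W :: "real \<Rightarrow> real"
  assumes "Ck_on 2 UNIV W"
  shows "(W has_real_derivative deriv W t) (at t)"
    "(deriv W has_real_derivative deriv (deriv W) t) (at t)"
    "continuous_on UNIV (deriv (deriv W))"
  using assms
  by (simp_all add: numeral_2_eq_2 partial_deriv_real DERIV_deriv_iff_real_differentiable)

lemma lipschitz_on_Icc:
  fixes f f' :: "real \<Rightarrow> real"
  assumes f: "\<And>t. (f has_real_derivative f' t) (at t)" and f': "continuous_on UNIV f'"
  shows "\<exists>L\<ge>0. \<forall>s\<in>{lo..hi}. \<forall>t\<in>{lo..hi}. \<bar>f s - f t\<bar> \<le> L * \<bar>s - t\<bar>"
proof -
  have "compact (f' ` {lo..hi})"
    by (intro compact_continuous_image continuous_on_subset[OF f']) auto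
  then obtain L where L: "L > 0" "\<And>t. t \<in> {lo..hi} \<Longrightarrow> \<bar>f' t\<bar> \<le> L"
    using compact_imp_bounded bounded_pos by (metis image_eqI real_norm_def)
  have less: "\<bar>f t - f s\<bar> \<le> L * \<bar>t - s\<bar>" if st: "s \<in> {lo..hi}" "t \<in> {lo..hi}" "s < t" for s t
  proof -
    obtain z where z: "s < z" "z < t" "f t - f s = (t - s) * f' z"
      using MVT2[OF st(3), of f f'] f by blast
    have "\<bar>f' z\<bar> \<le> L" using z st by (intro L) auto
    then have "\<bar>t - s\<bar> * \<bar>f' z\<bar> \<le> \<bar>t - s\<bar> * L" by (intro mult_left_mono) auto
    then show ?thesis using z by (simp add: abs_mult mult.commute)
  qed
  have "\<bar>f s - f t\<bar> \<le> L * \<bar>s - t\<bar>" if "s \<in> {lo..hi}" "t \<in> {lo..hi}" for s t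
    using less[OF that] less[OF that(2,1)] by (cases s t rule: linorder_cases) (auto simp: abs_minus_commute)
  then show ?thesis using L by (intro exI[of _ L]) auto
qed

theorem theorem1p9:
  fixes W :: "real \<Rightarrow> real" and a b R :: real and u :: "real ^ 'n \<Rightarrow> real"
  assumes "a < b"
    and "Ck_on 2 UNIV W"
    and "\<And>t. t \<in> {a<..<b} \<Longrightarrow> deriv W t < 0"
    and "deriv W a = 0"
    and "\<And>t. t > b \<Longrightarrow> W t \<ge> W b"
    and "(CARD('n) \<ge> 3 \<and>
            (\<exists>\<delta>>0. \<exists>\<alpha>\<in>{0<..<1}. Ck_alpha_on 6 \<alpha> {b - \<delta><..<b + \<delta>} W)) \<or>
         (CARD('n) \<ge> 2 \<and> (\<exists>\<delta>>0. convex_on {b - \<delta><..<b} W))"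
    and "Ck_on 2 UNIV u"
    and "\<And>x. laplacian u x = deriv W (u x)"
    and "R > 0"
    and "u ` (UNIV - ball 0 R) \<subseteq> {a<..<b}"
    and "(u \<longlongrightarrow> b) at_infinity"
  shows "(\<forall>x. u x < b) \<and> radially_symmetric u"
proof -

  \<comment> \<open>Signs and zeros of the nonlinearity\<close>
  note ab = assms(1) and neg = assms(3) and Wge = assms(5) and R = assms(9) and lim = assms(11)
  define f where "f = deriv W"
  define G where "G x = (\<Sum>e\<in>Basis. partial_deriv e u x *\<^sub>R e)" for x
  have dim: "DIM(real ^ 'n) = CARD('n)" by simp
  have Wd: "(W has_real_derivative f t) (at t)" and fd: "(f has_real_derivative deriv f t) (at t)"
    and f'c: "continuous_on UNIV (deriv f)" for t
    using C2_real[OF assms(2)] by (simp_all add: f_def)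
  have lapu: "has_lap u G (f (u x)) x" for x
    using has_lap_Ck2[OF assms(7), of x] by (simp add: assms(8) f_def G_def[abs_def])
  have out: "a < u x" "u x < b" if "norm x \<ge> R" for x
    using that assms(10) by (auto simp: image_subset_iff)
  have fneg: "f t < 0" if "a < t" "t < b" for t using neg that by (simp add: f_def)
  \<comment> \<open>From the left \<open>f\<close> is a limit of negative values; from the right,
    \<open>W\<close> not dropping below \<open>W b\<close> excludes a negative derivative.\<close>
  have fb: "f b = 0"
  proof (rule antisym)
    have "(f \<longlongrightarrow> f b) (at_left b)"
      using DERIV_isCont[OF fd] by (auto simp: isCont_def intro: filterlim_mono at_le)
    moreover have "\<forall>\<^sub>F t in at_left b. f t \<le> 0"
      using eventually_at_left_real[OF ab] by eventually_elim (auto intro: fneg less_imp_le)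
    ultimately show "f b \<le> 0" by (rule tendsto_upperbound) simp
    show "0 \<le> f b"
    proof (rule ccontr)
      assume "\<not> 0 \<le> f b"
      with DERIV_neg_dec_right[OF Wd, of b] obtain d where d: "d > 0" "\<And>h. 0 < h \<Longrightarrow> h < d \<Longrightarrow> W (b + h) < W b"
        by auto
      have "W (b + d/2) < W b" using d(1) by (intro d(2)) auto
      moreover have "W (b + d/2) \<ge> W b" using d(1) by (intro Wge) simp
      ultimately show False by linarith
    qed
  qed
  note lip = lipschitz_on_Icc[OF fd f'c]
  have dim2: "CARD('n) \<ge> 2" using assms(6) by auto

  \<comment> \<open>The strict upper bound\<close>
  have ule: "u x \<le> b" for x
  proof (rule solution_le[OF _ Wd lapu _ Wge R])
    fix M
    obtain L where L: "L \<ge> 0" "\<And>s t. s \<in> {b..M} \<Longrightarrow> t \<in> {b..M} \<Longrightarrow> \<bar>f s - f t\<bar> \<le> L * \<bar>s - t\<bar>"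
      using lip[of b M] by auto
    \<comment> \<open>Since \<open>f b = 0\<close>, a Lipschitz bound on \<open>f\<close> gives
      quadratic growth of \<open>W\<close>. The summand 1 keeps the constant positive when
      \<open>L = 0\<close>.\<close>
    have "W s - W b \<le> (L + 1) * (s - b)\<^sup>2" if s: "s \<in> {b..M}" for s
    proof (cases "s = b")
      case False
      then have "b < s" using s by simp
      from MVT2[OF this, of W f] Wd obtain z where z: "b < z" "z < s" "W s - W b = (s - b) * f z" by blast
      have "f z \<le> L * (z - b)" using L(2)[of z b] z s fb by auto
      also have "\<dots> \<le> (L + 1) * (s - b)" using z L(1) by (intro mult_mono) auto
      finally have "(s - b) * f z \<le> (s - b) * ((L + 1) * (s - b))" using z by (intro mult_left_mono) auto
      then show ?thesis using z by (simp add: power2_eq_square algebra_simps)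
    qed simp
    then show "\<exists>K>0. \<forall>s\<in>{b..M}. W s - W b \<le> K * (s - b)\<^sup>2" using L(1) by (intro exI[of _ "L + 1"]) auto
  qed (use dim2 out in auto)
  have uc: "continuous_on S u" for S
    using has_lapD(2)[OF lapu] by (simp add: continuous_at_imp_continuous_on)
  obtain lo where lo: "\<And>x. lo \<le> u x"
  proof -
    have "\<exists>y\<in>cball 0 R. \<forall>x\<in>cball 0 R. u y \<le> u x"
      using R by (intro continuous_attains_inf uc) auto
    then obtain y where y: "\<And>x. norm x \<le> R \<Longrightarrow> u y \<le> u x" by (metis mem_cball_0)
    have "min a (u y) \<le> u x" for x
      using y[of x] out[of x] by (cases "norm x \<le> R") auto
    then show ?thesis by (rule that)
  qed
  obtain L where L: "L \<ge> 0" and L': "\<forall>s\<in>{lo..b}. \<forall>t\<in>{lo..b}. \<bar>f s - f t\<bar> \<le> L * \<bar>s - t\<bar>"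
    using lip[of lo b] by blast
  have ran: "u x \<in> {lo..b}" "b \<in> {lo..b}" for x
    using lo[of x] ule[of x] by auto
  have Lip: "\<bar>f (u x) - f (u y)\<bar> \<le> L * \<bar>u x - u y\<bar>" for x y
    using L' ran(1) by blast
  have Lipb: "\<bar>f b - f (u x)\<bar> \<le> L * \<bar>b - u x\<bar>" for x
    using L' ran by blast
  have lapw: "has_lap (\<lambda>x. b - u x) (\<lambda>x. 0 - G x) (0 - f (u x)) x" for x
    by (intro has_lap_diff has_lap_const lapu)
  have ub: "u x < b" for x
  proof -
    \<comment> \<open>If \<open>b - u\<close> had a zero, the strong maximum principle would make it
      vanish everywhere, but it is positive at points of norm \<open>R\<close>.\<close>
    have "u x \<noteq> b"
    proof
      assume "u x = b"
      obtain e :: "real ^ 'n" where e: "e \<in> Basis" using nonempty_Basis by blast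
      have "b - u (R *\<^sub>R e) = 0"
      proof (rule strong_maximum_principle[OF open_UNIV connected_UNIV L, where v = "\<lambda>x. b - u x" and z = x])
        show "\<exists>l. has_lap (\<lambda>x. b - u x) (\<lambda>x. 0 - G x) l y \<and> l \<le> L * (b - u y)" for y
          using lapw[of y] Lipb[of y] ule[of y] fb by (intro exI[of _ "0 - f (u y)"]) auto
      qed (use ule \<open>u x = b\<close> in auto)
      then show False using out(2)[of "R *\<^sub>R e"] e R by simp
    qed
    then show ?thesis using ule[of x] by simp
  qed
  have near: "\<exists>r. \<forall>x. norm x \<ge> r \<longrightarrow> u x > b - \<epsilon>" if "\<epsilon> > 0" for \<epsilon>
    using order_tendstoD(1)[OF lim, of "b - \<epsilon>"] that by (simp add: eventually_at_infinity)
  have limw: "((\<lambda>x. b - u x) \<longlongrightarrow> 0) at_infinity" using tendsto_diff[OF tendsto_const lim, of b] by simp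
  from assms(6) have "radially_symmetric u"
  proof (elim disjE conjE exE bexE)

    \<comment> \<open>Symmetry for a potential convex to the left of \<open>b\<close>\<close>
    fix \<delta> assume \<delta>: "0 < \<delta>" "convex_on {b - \<delta><..<b} W"
    have mono: "f s \<le> f t" if st: "b - \<delta> < s" "s < t" "t < b" for s t
    proof -
      have "W y - W x \<ge> f x * (y - x)" if "x \<in> {b - \<delta><..<b}" "y \<in> {b - \<delta><..<b}" for x y
        using that by (intro convex_on_imp_above_tangent[OF \<delta>(2)] has_field_derivative_at_within[OF Wd]) auto
      \<comment> \<open>Adding the two tangent inequalities of the convex potential yields
        monotonicity of its derivative.\<close>
      from this[of s t] this[of t s] st have "(f t - f s) * (t - s) \<ge> 0" by (simp add: algebra_simps)
      then show ?thesis using st by (simp add: zero_le_mult_iff)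
    qed
    obtain r where r: "\<And>x. norm x \<ge> r \<Longrightarrow> u x > b - \<delta>" using near[OF \<delta>(1)] by blast
    \<comment> \<open>Here \<open>rad \<kappa>\<close> is |x|^(-n), whose Laplacian
      \<open>2 * real CARD('n) * rad (\<kappa> - 1) x\<close> is positive, so that \<open>g\<close>
      is strictly superharmonic yet at least 1 outside the unit ball.\<close>
    define \<kappa> where "\<kappa> = - real CARD('n) / 2"
    define g where "g x = 2 - rad \<kappa> x" for x :: "real ^ 'n"
    have g1: "g x \<ge> 1" if "norm x \<ge> 1" for x
      using rad_mono[OF that, of \<kappa> 0] that by (cases "x = 0") (auto simp: g_def \<kappa>_def rad_def)
    have "moving_planes u G f b L (max 1 r) g (\<lambda>x. 0 - 2 * real CARD('n) * rad (\<kappa> - 1) x)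
      (\<lambda>_. 0) (\<lambda>y. 0 - (\<kappa> * rad (\<kappa> - 1) y) *\<^sub>R (2 *\<^sub>R y))"
    proof
      show "has_lap g (\<lambda>y. 0 - (\<kappa> * rad (\<kappa> - 1) y) *\<^sub>R (2 *\<^sub>R y)) (0 - 2 * real CARD('n) * rad (\<kappa> - 1) x) x"
        if "norm x \<ge> max 1 r" for x
      proof -
        have "x \<noteq> 0" using that by auto
        from has_lap_diff[OF has_lap_const has_lap_rad[OF this], of 2 \<kappa>]
        show ?thesis by (simp add: g_def[abs_def] \<kappa>_def mult_ac)
      qed
      show "0 - 2 * real CARD('n) * rad (\<kappa> - 1) x < - (0 * g x)" if "norm x \<ge> max 1 r" for x
      proof -
        have "x \<noteq> 0" using that by auto
        then have "2 * real CARD('n) * rad (\<kappa> - 1) x > 0" using dim2 by (intro mult_pos_pos rad_pos) auto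
        then show ?thesis by simp
      qed
      show "f (u x) - f t \<le> 0 * (t - u x)" if "norm x \<ge> max 1 r" "u x < t" "t < b" for x t
        using mono[of "u x" t] r[of x] that by simp
      show "\<exists>r. \<forall>x. norm x \<ge> r \<longrightarrow> b - u x \<le> \<epsilon> * g x" if \<epsilon>: "\<epsilon> > 0" for \<epsilon>
      proof -
        obtain r' where r': "\<And>x. norm x \<ge> r' \<Longrightarrow> u x > b - \<epsilon>" using near[OF \<epsilon>] by blast
        have "b - u x \<le> \<epsilon> * g x" if "norm x \<ge> max r' 1" for x
        proof -
          have "\<epsilon> * 1 \<le> \<epsilon> * g x" using that \<epsilon> by (intro mult_left_mono g1) auto
          then show ?thesis using r'[of x] that by simp
        qed
        then show ?thesis by blast
      qed
      show "g x > 0" if "norm x \<ge> max 1 r" for x using g1[of x] that by simp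
    qed (fact lapu ub lim L Lip)+
    then show ?thesis by (rule moving_planes.radially_symmetric)
  next

    \<comment> \<open>Symmetry for a smooth potential in dimension at least three\<close>
    fix \<delta> \<alpha> assume dim3: "3 \<le> CARD('n)" and \<delta>: "0 < \<delta>" and W6: "Ck_alpha_on 6 \<alpha> {b - \<delta><..<b + \<delta>} W"
    define D where "D m = (deriv ^^ m) W" for m
    have D12: "D 1 = f" "D 2 = deriv f" by (auto simp: D_def f_def numeral_2_eq_2)
    have Dd: "(D m has_real_derivative D (Suc m) t) (at t)" if "m < 6" "b - \<delta> < t" "t < b + \<delta>" for m t
      using Ck_alpha_on_derivs[OF W6 that(1), of t] that by (simp add: D_def)
    have "\<exists>\<eta>>0. \<exists>K\<ge>0. \<forall>t. b - \<eta> < t \<and> t < b \<longrightarrow> D 2 t \<ge> - (K * (b - t) ^ 3)"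
    proof (rule deriv2_lower_bound[OF \<delta> _ _ _ ab])
      show "isCont (D 5) b" using DERIV_isCont[OF Dd[of 5 b]] \<delta> by simp
    qed (use Dd fb fneg in \<open>auto simp: D12 D12(1)[unfolded One_nat_def]\<close>)
    then obtain \<eta> K where \<eta>: "\<eta> > 0" and K: "K \<ge> 0"
      and low: "\<And>t. b - \<eta> < t \<Longrightarrow> t < b \<Longrightarrow> deriv f t \<ge> - (K * (b - t) ^ 3)"
      unfolding D12 by blast
    \<comment> \<open>Outside the ball the Laplacian of \<open>b - u\<close> is
      \<open>- f (u x)\<close>, which is positive there.\<close>
    have "\<exists>C>0. \<forall>x. norm x \<ge> R \<longrightarrow> b - u x \<le> C * rad (1 - real DIM(real ^ 'n) / 2) x"
    proof (rule exterior_decay[OF R lapw _ limw])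
      show "0 - f (u x) > 0" if "norm x \<ge> R" for x using fneg out[OF that] by simp
    qed (use dim3 in simp)
    then obtain C where C: "C > 0" and Cd: "\<And>x. norm x \<ge> R \<Longrightarrow> b - u x \<le> C * rad (1 - real CARD('n) / 2) x"
      by auto
    obtain r where r: "\<And>x. norm x \<ge> r \<Longrightarrow> u x > b - \<eta>" using near[OF \<eta>] by blast
    \<comment> \<open>Beyond \<open>R\<close> the decay estimate holds, beyond \<open>r\<close> the
      bound on \<open>deriv f\<close>, beyond 1 \<open>rad\<close> is monotone in its exponent, and
      the last entry makes \<open>K * C ^ 3 / norm x\<close> smaller than 1/4.\<close>
    define R0 where "R0 = max (max R r) (max 1 (4 * (K * C ^ 3) + 1))"
    have R0: "norm x \<ge> R" "norm x \<ge> r" "norm x \<ge> 1" "norm x > 4 * (K * C ^ 3)" if "norm x \<ge> R0" for x :: "real ^ 'n"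
      using that by (auto simp: R0_def)
    have dec: "b - u x \<le> C * rad (- 1/2) x" if "norm x \<ge> R" "norm x \<ge> 1" for x
    proof -
      have "C * rad (1 - real CARD('n) / 2) x \<le> C * rad (- 1/2) x"
        using C dim3 that by (intro mult_left_mono rad_mono) auto
      then show ?thesis using Cd[OF that(1)] by simp
    qed
    \<comment> \<open>The bound \<open>K * (b - t) ^ 3\<close> on \<open>- deriv f t\<close>, with
      \<open>b - t\<close> replaced by its decay rate \<open>C * rad (- 1/2) x\<close>.\<close>
    define c0 where "c0 x = K * (C ^ 3 * rad (- 3/2) x)" for x :: "real ^ 'n"
    \<comment> \<open>This is |x|^(-1/2). Minus its Laplacian is (n - 5/2)/2 times |x|^(-5/2), a
      coefficient of at least 1/4 for n at least 3, which beats \<open>c0 x * g x\<close> for large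
      |x|.\<close>
    define g where "g = (rad (- 1/4) :: real ^ 'n \<Rightarrow> real)"
    define lg where "lg x = 2 * (- 1/4) * (2 * (- 1/4) - 2 + real DIM(real ^ 'n)) * rad (- 1/4 - 1) x" for x :: "real ^ 'n"
    have "moving_planes u G f b L R0 g lg c0 (\<lambda>y. (- 1/4 * rad (- 1/4 - 1) y) *\<^sub>R (2 *\<^sub>R y))"
    proof
      show "has_lap g (\<lambda>y. (- 1/4 * rad (- 1/4 - 1) y) *\<^sub>R (2 *\<^sub>R y)) (lg x) x" if "norm x \<ge> R0" for x
        unfolding g_def lg_def using R0(3)[OF that] by (intro has_lap_rad) auto
      show "g x > 0" if "norm x \<ge> R0" for x
        unfolding g_def using R0(3)[OF that] by (intro rad_pos) auto
      show "lg x < - (c0 x * g x)" if "norm x \<ge> R0" for x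
      proof -
        have x0: "x \<noteq> 0" and nx: "norm x > 0" using R0(3)[OF that] by auto
        have p: "rad (- 5/4) x > 0" by (rule rad_pos[OF x0])
        have half: "rad (- 1/2) x = 1 / norm x"
          by (simp add: rad_def powr_minus_divide powr_half_sqrt)
        have "rad (- 3/2) x * rad (- 1/4) x = rad (- 1/2) x * rad (- 5/4) x"
          unfolding rad_add[symmetric] by simp
        then have "c0 x * g x = (K * C ^ 3 / norm x) * rad (- 5/4) x"
          unfolding c0_def g_def half by (simp add: mult.assoc)
        also have "\<dots> < 1/4 * rad (- 5/4) x"
        proof (rule mult_strict_right_mono[OF _ p])
          show "K * C ^ 3 / norm x < 1/4" using R0(4)[OF that] by (simp add: pos_divide_less_eq[OF nx])
        qed
        also have "\<dots> \<le> - lg x"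
        proof -
          have "1/4 * rad (- 5/4) x \<le> (1/2 * (real CARD('n) - 5/2)) * rad (- 5/4) x"
            using p dim3 by (intro mult_right_mono) auto
          also have "\<dots> = - lg x"
          proof -
            have "rad (- 1/4 - 1) x = rad (- 5/4) x" by simp
            then show ?thesis unfolding lg_def dim by (simp only:) (simp add: algebra_simps)
          qed
          finally show ?thesis .
        qed
        finally show ?thesis by simp
      qed
      show "f (u x) - f t \<le> c0 x * (t - u x)" if x: "norm x \<ge> R0" and t: "u x < t" "t < b" for x t
      proof -
        obtain z where z: "u x < z" "z < t" "f t - f (u x) = (t - u x) * deriv f z"
          using MVT2[OF t(1), of f "deriv f"] fd by blast
        have "deriv f z \<ge> - (K * (b - z) ^ 3)" using z t r[of x] R0(2)[OF x] by (intro low) auto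
        moreover have "(b - z) ^ 3 \<le> (C * rad (- 1/2) x) ^ 3"
          using dec[of x] R0[OF x] z t by (intro power_mono) auto
        then have "K * (b - z) ^ 3 \<le> K * (C * rad (- 1/2) x) ^ 3" using K by (rule mult_left_mono)
        moreover have "K * (C * rad (- 1/2) x) ^ 3 = c0 x"
        proof -
          have "rad (- 1/2) x ^ 3 = rad (- 3/2) x"
            unfolding power3_eq_cube rad_add[symmetric] by simp
          then show ?thesis by (simp only: c0_def power_mult_distrib)
        qed
        ultimately have "deriv f z \<ge> - c0 x" by linarith
        then have "(t - u x) * deriv f z \<ge> (t - u x) * - c0 x" using t by (intro mult_left_mono) auto
        then show ?thesis using z(3) by (simp add: algebra_simps)
      qed
      show "\<exists>r. \<forall>x. norm x \<ge> r \<longrightarrow> b - u x \<le> \<epsilon> * g x" if \<epsilon>: "\<epsilon> > 0" for \<epsilon>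
      proof -
        have "\<forall>\<^sub>F x in at_infinity. g x < \<epsilon> / C"
          unfolding g_def using \<epsilon> C by (intro order_tendstoD(2)[OF rad_tendsto_0]) auto
        then obtain r' where r': "\<And>x. norm x \<ge> r' \<Longrightarrow> g x < \<epsilon> / C" unfolding eventually_at_infinity by blast
        have "b - u x \<le> \<epsilon> * g x" if "norm x \<ge> max r' R0" for x
        proof -
          have "g x > 0" unfolding g_def using R0(3)[of x] that by (intro rad_pos) auto
          moreover have "C * g x \<le> \<epsilon>" using r'[of x] that C by (simp add: field_simps)
          ultimately have "C * g x * g x \<le> \<epsilon> * g x" by (intro mult_right_mono) auto
          \<comment> \<open>The bound on \<open>b - u\<close> is a multiple of the square of
            \<open>g\<close>, and \<open>g\<close> itself tends to 0.\<close>
          moreover have "C * g x * g x = C * rad (- 1/2) x"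
            unfolding g_def mult.assoc rad_add[symmetric] by simp
          moreover have "b - u x \<le> C * rad (- 1/2) x" using that by (intro dec R0) auto
          ultimately show ?thesis by linarith
        qed
        then show ?thesis by blast
      qed
    qed (fact lapu ub lim L Lip)+
    then show ?thesis by (rule moving_planes.radially_symmetric)
  qed
  with ub show ?thesis by blast
qed

end
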